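(* Let $f=(f_n)_{n\in\mathbb{N}}$ be an arbitrary family of Boolean functions $f_n:\{0,1\}^n\times\{0,1\}^n\to\{0,1\}$. Then there is a computable time bound $t:\mathbb{N}\to\mathbb{N}$ and a constant $c$ (independent of $n$) such that for every $n$, $$\Bigl|\,N(f_n) - \max_{x,y\in\{0,1\}^n}\text{\rm ic}^{f,t}\bigl(y:Y_1(x)\bigr)\Bigr|\le c .$$
   Context: Communication setting: Alice holds $\overline{x}\in\{0,1\}^n$, Bob holds $\overline{y}\in\{0,1\}^n$, both know $f_n$ and have unbounded computational power. For $z\in\{0,1\}$, a one-sided non-deterministic protocol $P^z$ with output set $\{z,\bot\}$ receives an untrusted guess $w$, the players exchange bits (conversation $c(w)$), and output $z$ or $\bot$, such that: if $f_n(\overline{x},\overline{y})=z$ then some $w$ gives output $z$; if $f_n(\overline{x},\overline{y})\neq z$ then every $w$ gives output $\bot$. For $(\overline{x},\overline{y})$ with $f_n(\overline{x},\overline{y})=z$ let $\mathcal{N}^z_P(f_n,\overline{x},\overline{y})=\min_w\{|c(w)| : P(w,\overline{x},\overline{y})=z\}$ and $N^z_P(f_n)=\max_{\overline{x},\overline{y}}\mathcal{N}^z_P(f_n,\overline{x},\overline{y})$. A (two-sided) non-deterministic protocol $P$ for $f_n$ outputs values in $\{0,1,\bot\}$ and satisfies, for $z\in\{0,1\}$: if $f_n(\overline{x},\overline{y})=z$ then $\exists w\,P(w,\overline{x},\overline{y})=z$; if $f_n(\overline{x},\overline{y})\neq z$ then $\forall w\,P(w,\overline{x},\overline{y})\neq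 z$. Set $N_P(f_n)=\log_2(2^{N^0_P(f_n)}+2^{N^1_P(f_n)})$ and $N(f_n)=\min_P N_P(f_n)$. For $x\in\{0,1\}^n$, $Y_1(x)=\{y\in\{0,1\}^n : f_n(x,y)=1\}$. Instance complexity: programs are for a fixed universal machine and may query an oracle $f$ which, on inputs of length $n$, provides the description (truth table) of $f_n$. A program $p$ is consistent with a set $A$ if $p(y)=1$ implies $y\in A$ and $p(y)=0$ implies $y\notin A$. For a time bound $t$, a set $A$ and an element $x$, $\text{\rm ic}^{f,t}(x:A)$ is the minimum length $|p|$ of a total program $p$ with oracle access to $f$ such that: (C1) for all $y$, $p(y)$ runs in at most $t(|y|)$ steps; (C2) for all $y$, $p(y)\in\{0,1,\bot\}$; (C3) $p$ is consistent with $A$; (C4) $p(x)\neq\bot$.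
   Formalization: Consistency of p with Y_1(x) is required only on strings of length n (over all lengths the claim fails for f_n constantly 1), and the guess w is split into private parts for Alice and Bob, since a free shared guess would make N(f_n) bounded. *)

theory Defs
  imports Complex_Main "HOL-Library.Extended_Real"
begin

definition strings :: "nat \<Rightarrow> bool list set" where
  "strings n = {u. length u = n}"


section \<open>Non-deterministic communication complexity\<close>

text \<open>
  The guess \<open>w = (wA, wB)\<close> is held privately: each player sees only their own part. Only the
  conversation is charged, so a guess visible to both players for free would let them verify
  membership in a guessed monochromatic rectangle with two bits, for every function.
  The first subtree of a node is taken on bit 0, the second one on bit 1; \<open>None\<close> is \<open>\<bottom>\<close>.
\<close>

type_synonym guess = "bool list \<times> bool list"

datatype protocol =
    Output "bool option"
  | Alice "bool list \<Rightarrow> bool list \<Rightarrow> bool" protocol protocol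
  | Bob "bool list \<Rightarrow> bool list \<Rightarrow> bool" protocol protocol

primrec outcome :: "protocol \<Rightarrow> guess \<Rightarrow> bool list \<Rightarrow> bool list \<Rightarrow> bool option" where
  "outcome (Output r) w x y = r"
| "outcome (Alice a P Q) w x y =
     (if a (fst w) x then outcome Q w x y else outcome P w x y)"
| "outcome (Bob b P Q) w x y =
     (if b (snd w) y then outcome Q w x y else outcome P w x y)"

primrec conversation :: "protocol \<Rightarrow> guess \<Rightarrow> bool list \<Rightarrow> bool list \<Rightarrow> bool list" where
  "conversation (Output r) w x y = []"
| "conversation (Alice a P Q) w x y =
     a (fst w) x # (if a (fst w) x then conversation Q w x y else conversation P w x y)"
| "conversation (Bob b P Q) w x y =
     b (snd w) y # (if b (snd w) y then conversation Q w x y else conversation P w x y)"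

definition nondet_protocol ::
    "nat \<Rightarrow> (bool list \<Rightarrow> bool list \<Rightarrow> bool) \<Rightarrow> protocol \<Rightarrow> bool" where
  "nondet_protocol n g P \<longleftrightarrow>
     (\<forall>x\<in>strings n. \<forall>y\<in>strings n. \<forall>z.
        (g x y = z \<longrightarrow> (\<exists>w. outcome P w x y = Some z)) \<and>
        (g x y \<noteq> z \<longrightarrow> (\<forall>w. outcome P w x y \<noteq> Some z)))"

definition instance_cost :: "protocol \<Rightarrow> bool \<Rightarrow> bool list \<Rightarrow> bool list \<Rightarrow> nat" where
  "instance_cost P z x y =
     (LEAST k. \<exists>w. outcome P w x y = Some z \<and> k = length (conversation P w x y))"

text \<open>The maximum over an empty set of inputs (constant functions) is taken to be 0.\<close>

definition one_sided_cost ::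
    "nat \<Rightarrow> (bool list \<Rightarrow> bool list \<Rightarrow> bool) \<Rightarrow> protocol \<Rightarrow> bool \<Rightarrow> nat" where
  "one_sided_cost n g P z =
     Max (insert 0 {instance_cost P z x y | x y. x \<in> strings n \<and> y \<in> strings n \<and> g x y = z})"

definition protocol_cost ::
    "nat \<Rightarrow> (bool list \<Rightarrow> bool list \<Rightarrow> bool) \<Rightarrow> protocol \<Rightarrow> real" where
  "protocol_cost n g P =
     log 2 (2 ^ one_sided_cost n g P False + 2 ^ one_sided_cost n g P True)"

definition nondet_complexity :: "nat \<Rightarrow> (bool list \<Rightarrow> bool list \<Rightarrow> bool) \<Rightarrow> real" where
  "nondet_complexity n g = (LEAST r. \<exists>P. nondet_protocol n g P \<and> r = protocol_cost n g P)"


section \<open>Oracle machines\<close>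

text \<open>
  While programs over registers holding bit stacks. Every instruction touches at most the top of
  one stack, so this is the multi-tape Turing machine model (a tape being a pair of stacks)
  with structured control. The oracle is a map from lengths to strings.
\<close>

datatype test = Nonempty nat | Top nat

datatype com =
    Skip
  | Push nat bool
  | Pop nat
  | Query nat
  | Seq com com
  | Cond test com com
  | While test com

type_synonym state = "nat \<Rightarrow> bool list"

primrec holds :: "test \<Rightarrow> state \<Rightarrow> bool" where
  "holds (Nonempty r) s \<longleftrightarrow> s r \<noteq> []"
| "holds (Top r) s \<longleftrightarrow> s r \<noteq> [] \<and> hd (s r)"

text \<open>\<open>exec Or c s k s'\<close>: started in \<open>s\<close>, \<open>c\<close> halts after exactly \<open>k\<close> steps in \<open>s'\<close>.\<close>

inductive exec :: "(nat \<Rightarrow> bool list) \<Rightarrow> com \<Rightarrow> state \<Rightarrow> nat \<Rightarrow> state \<Rightarrow> bool"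
  for Or :: "nat \<Rightarrow> bool list" where
  Skip: "exec Or Skip s 1 s"
| Push: "exec Or (Push r b) s 1 (s(r := b # s r))"
| Pop: "exec Or (Pop r) s 1 (s(r := tl (s r)))"
| Query: "exec Or (Query r) s 1 (s(r := Or (length (s r))))"
| Seq: "exec Or c s k s' \<Longrightarrow> exec Or d s' l s'' \<Longrightarrow> exec Or (Seq c d) s (k + l) s''"
| CondTrue: "holds b s \<Longrightarrow> exec Or c s k s' \<Longrightarrow> exec Or (Cond b c d) s (Suc k) s'"
| CondFalse: "\<not> holds b s \<Longrightarrow> exec Or d s k s' \<Longrightarrow> exec Or (Cond b c d) s (Suc k) s'"
| WhileFalse: "\<not> holds b s \<Longrightarrow> exec Or (While b c) s 1 s"
| WhileTrue: "holds b s \<Longrightarrow> exec Or c s k s' \<Longrightarrow> exec Or (While b c) s' l s'' \<Longrightarrow>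
    exec Or (While b c) s (Suc (k + l)) s''"

inductive_cases exec_SkipE: "exec Or Skip s k s'"
inductive_cases exec_PushE: "exec Or (Push r b) s k s'"
inductive_cases exec_PopE: "exec Or (Pop r) s k s'"
inductive_cases exec_QueryE: "exec Or (Query r) s k s'"
inductive_cases exec_SeqE: "exec Or (Seq c d) s k s'"
inductive_cases exec_CondE: "exec Or (Cond b c d) s k s'"
inductive_cases exec_WhileE: "exec Or (While b c) s k s'"

lemma exec_deterministic:
  "exec Or c s k s1 \<Longrightarrow> exec Or c s l s2 \<Longrightarrow> k = l \<and> s1 = s2"
proof (induction arbitrary: l s2 rule: exec.induct)
  case (Skip s)
  then show ?case by (auto elim: exec_SkipE)
next
  case (Push r b s)
  then show ?case by (auto elim: exec_PushE)
next
  case (Pop r s)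
  then show ?case by (auto elim: exec_PopE)
next
  case (Query r s)
  then show ?case by (auto elim: exec_QueryE)
next
  case (Seq c s k s' d m s'')
  from Seq.prems obtain i j s3
    where "exec Or c s i s3" "exec Or d s3 j s2" "l = i + j"
    by (rule exec_SeqE) blast
  with Seq.IH show ?case by blast
next
  case (CondTrue b s c k s' d)
  from CondTrue.prems CondTrue.hyps obtain i where "exec Or c s i s2" "l = Suc i"
    by (auto elim: exec_CondE)
  with CondTrue.IH show ?case by blast
next
  case (CondFalse b s d k s' c)
  from CondFalse.prems CondFalse.hyps obtain i where "exec Or d s i s2" "l = Suc i"
    by (auto elim: exec_CondE)
  with CondFalse.IH show ?case by blast
next
  case (WhileFalse b s c)
  from WhileFalse.prems WhileFalse.hyps show ?case by (auto elim: exec_WhileE)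
next
  case (WhileTrue b s c k s' m s'')
  from WhileTrue.prems WhileTrue.hyps(1) obtain i j s3
    where "exec Or c s i s3" "exec Or (While b c) s3 j s2" "l = Suc (i + j)"
    by (auto elim: exec_WhileE)
  with WhileTrue.IH show ?case by blast
qed

text \<open>Register 0 holds the input, and the output after halting; register 1 a second input.\<close>

definition initial :: "bool list \<Rightarrow> bool list \<Rightarrow> state" where
  "initial y w = (\<lambda>_. [])(0 := y, 1 := w)"

text \<open>Numbers are in unary; with the constantly empty oracle, queries only clear a register.\<close>

definition computable :: "(nat \<Rightarrow> nat) \<Rightarrow> bool" where
  "computable t \<longleftrightarrow>
     (\<exists>c. \<forall>n. \<exists>k s. exec (\<lambda>_. []) c (initial (replicate n True) []) k s \<and>
        s 0 = replicate (t n) True)"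


section \<open>The universal machine\<close>

primrec encode_nat :: "nat \<Rightarrow> bool list" where
  "encode_nat 0 = [False]"
| "encode_nat (Suc n) = True # encode_nat n"

primrec encode_test :: "test \<Rightarrow> bool list" where
  "encode_test (Nonempty r) = False # encode_nat r"
| "encode_test (Top r) = True # encode_nat r"

primrec encode :: "com \<Rightarrow> bool list" where
  "encode Skip = [False, False, False]"
| "encode (Push r b) = [False, False, True, b] @ encode_nat r"
| "encode (Pop r) = [False, True, False] @ encode_nat r"
| "encode (Query r) = [False, True, True] @ encode_nat r"
| "encode (Seq c d) = [True, False, False] @ encode c @ encode d"
| "encode (Cond b c d) = [True, False, True] @ encode_test b @ encode c @ encode d"
| "encode (While b c) = [True, True, False] @ encode_test b @ encode c"

lemma encode_nat_prefix_free: "encode_nat m @ u = encode_nat n @ v \<Longrightarrow> m = n \<and> u = v"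
proof (induction m arbitrary: n)
  case 0
  then show ?case by (cases n) auto
next
  case (Suc m)
  then show ?case by (cases n) auto
qed

lemma encode_test_prefix_free: "encode_test b @ u = encode_test b' @ v \<Longrightarrow> b = b' \<and> u = v"
  by (cases b; cases b') (auto dest: encode_nat_prefix_free)

lemma encode_prefix_free: "encode c @ u = encode d @ v \<Longrightarrow> c = d \<and> u = v"
proof (induction c arbitrary: d u v)
  case Skip
  then show ?case by (cases d) simp_all
next
  case (Push r b)
  then show ?case by (cases d) (simp_all, metis encode_nat_prefix_free)
next
  case (Pop r)
  then show ?case by (cases d) (simp_all, metis encode_nat_prefix_free)
next
  case (Query r)
  then show ?case by (cases d) (simp_all, metis encode_nat_prefix_free)
next
  case (Seq c1 c2)
  from Seq.prems show ?case by (cases d) (simp_all, metis Seq.IH)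
next
  case (Cond b c1 c2)
  from Cond.prems show ?case
    by (cases d) (simp_all, metis Cond.IH encode_test_prefix_free)
next
  case (While b c)
  from While.prems show ?case
    by (cases d) (simp_all, metis While.IH encode_test_prefix_free)
qed

text \<open>
  \<open>universal Or p y k v\<close>: with oracle \<open>Or\<close>, program \<open>p\<close> halts on \<open>y\<close> after \<open>k\<close> steps with output
  \<open>v\<close>. A program is a self-delimiting machine code followed by data for that machine, so every
  machine is simulated at the price of a constant number of program bits; strings that do not
  start with a machine code diverge.
\<close>

definition universal ::
    "(nat \<Rightarrow> bool list) \<Rightarrow> bool list \<Rightarrow> bool list \<Rightarrow> nat \<Rightarrow> bool list \<Rightarrow> bool" where
  "universal Or p y k v \<longleftrightarrow>
     (\<exists>c w s. p = encode c @ w \<and> exec Or c (initial y w) k s \<and> s 0 = v)"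

lemma universal_deterministic:
  "universal Or p y k v \<Longrightarrow> universal Or p y l v' \<Longrightarrow> k = l \<and> v = v'"
  unfolding universal_def by (metis encode_prefix_free exec_deterministic)


section \<open>Instance complexity\<close>

definition truth_table :: "(nat \<Rightarrow> bool list \<Rightarrow> bool list \<Rightarrow> bool) \<Rightarrow> nat \<Rightarrow> bool list" where
  "truth_table f n =
     [f n x y. x \<leftarrow> List.n_lists n [False, True], y \<leftarrow> List.n_lists n [False, True]]"

text \<open>Outputs of programs: \<open>[True]\<close> is 1, \<open>[False]\<close> is 0, \<open>[]\<close> is \<open>\<bottom>\<close>; other strings are invalid.\<close>

definition returns ::
    "(nat \<Rightarrow> bool list \<Rightarrow> bool list \<Rightarrow> bool) \<Rightarrow> bool list \<Rightarrow> bool list \<Rightarrow> bool list \<Rightarrow> bool" where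
  "returns f p y v \<longleftrightarrow> (\<exists>k. universal (truth_table f) p y k v)"

text \<open>
  The sets \<open>A\<close> of interest consist of strings of length \<open>n\<close>, and consistency with \<open>A\<close> concerns
  that universe only. Demanding it at other lengths as well would force programs to encode \<open>n\<close>:
  for the constant functions 1 the complexity would be unbounded although \<open>N(f\<^sub>n)\<close> is bounded.
\<close>

definition consistent ::
    "(nat \<Rightarrow> bool list \<Rightarrow> bool list \<Rightarrow> bool) \<Rightarrow> nat \<Rightarrow> bool list \<Rightarrow> bool list set \<Rightarrow> bool" where
  "consistent f n p A \<longleftrightarrow>
     (\<forall>u\<in>strings n. (returns f p u [True] \<longrightarrow> u \<in> A) \<and> (returns f p u [False] \<longrightarrow> u \<notin> A))"

definition ic_program ::
    "(nat \<Rightarrow> bool list \<Rightarrow> bool list \<Rightarrow> bool) \<Rightarrow> (nat \<Rightarrow> nat) \<Rightarrow> nat \<Rightarrow> bool list \<Rightarrow> bool list set \<Rightarrow>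
      bool list \<Rightarrow> bool" where
  "ic_program f t n x A p \<longleftrightarrow>
     (\<forall>u. \<exists>k v. universal (truth_table f) p u k v \<and> k \<le> t (length u)) \<and>
     (\<forall>u v. returns f p u v \<longrightarrow> v \<in> {[False], [True], []}) \<and>
     consistent f n p A \<and>
     \<not> returns f p x []"

text \<open>The value is \<open>\<infinity>\<close> if there is no such program.\<close>

definition ic ::
    "(nat \<Rightarrow> bool list \<Rightarrow> bool list \<Rightarrow> bool) \<Rightarrow> (nat \<Rightarrow> nat) \<Rightarrow> nat \<Rightarrow> bool list \<Rightarrow> bool list set \<Rightarrow>
      enat" where
  "ic f t n x A = (INF p \<in> {p. ic_program f t n x A p}. enat (length p))"

definition Y1 ::
    "(nat \<Rightarrow> bool list \<Rightarrow> bool list \<Rightarrow> bool) \<Rightarrow> nat \<Rightarrow> bool list \<Rightarrow> bool list set" where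
  "Y1 f n x = {y \<in> strings n. f n x y}"

end

theory Submission
  imports Defs
begin

text \<open>
  Both quantities equal, up to a constant, the logarithm of the least number of rows of a table of
  partial predicates on \<open>{0,1}\<^sup>n\<close> such that for all \<open>x, y\<close> some row is consistent with \<open>f\<^sub>n x\<close> and
  defined at \<open>y\<close>. Conversations, respectively programs, index such a table. Conversely, Alice can
  guess and announce a row consistent with her input, whereupon Bob evaluates it. For instance
  complexity, a fixed machine queries the truth table, searches exhaustively for the first table
  with \<open>2\<^sup>l\<close> rows, where \<open>l\<close> is the number of data bits of the program, and answers according to
  the row that these bits name. This search is primitive recursive with every loop bounded in
  advance, so that its running time has a computable bound not depending on \<open>f\<close>.
\<close>

section \<open>Loop programs\<close>

text \<open>One machine has to serve every \<open>n\<close>, and its programs have to halt within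
  \<open>t\<close> on inputs of all lengths, also where their data bits name nothing sensible. The
  bounded search then answers with the undefined value if no suitable table exists; consistency is
  demanded at length \<open>n\<close> only. Taking the least table makes data strings of equal
  length refer to rows of the same table. The obstacle for the time bound is that program data are
  not bounded in terms of the input. Hence at most as many data bits as input bits are read, which
  suffices because one row per \<open>x\<close> already gives a table with \<open>2 ^ n\<close>
  rows. The bound \<open>t\<close> itself is computed without the oracle: it is built along the loop
  program, from the length \<open>4 ^ n\<close> of a truth table.\<close>

datatype prog =
    PSkip
  | PPush nat bool
  | PPop nat
  | PQuery nat
  | PSeq prog prog  (infixr ";;" 60)
  | PCond test prog prog
  | For nat prog

text \<open>A total function, since the number of rounds of a loop is fixed at entry by the length
  of its register. It agrees with the compiled while loop if the body leaves that register alone, as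
  \<open>tame\<close> demands.\<close>

primrec sem :: "(nat \<Rightarrow> bool list) \<Rightarrow> prog \<Rightarrow> state \<Rightarrow> state" where
  "sem Or PSkip = (\<lambda>s. s)"
| "sem Or (PPush r b) = (\<lambda>s. s(r := b # s r))"
| "sem Or (PPop r) = (\<lambda>s. s(r := tl (s r)))"
| "sem Or (PQuery r) = (\<lambda>s. s(r := Or (length (s r))))"
| "sem Or (p ;; q) = (\<lambda>s. sem Or q (sem Or p s))"
| "sem Or (PCond b p q) = (\<lambda>s. if holds b s then sem Or p s else sem Or q s)"
| "sem Or (For r p) =
     (\<lambda>s. ((\<lambda>s. (sem Or p s)(r := tl (sem Or p s r))) ^^ length (s r)) s)"

primrec compile :: "prog \<Rightarrow> com" where
  "compile PSkip = Skip"
| "compile (PPush r b) = Push r b"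
| "compile (PPop r) = Pop r"
| "compile (PQuery r) = Query r"
| "compile (p ;; q) = Seq (compile p) (compile q)"
| "compile (PCond b p q) = Cond b (compile p) (compile q)"
| "compile (For r p) = While (Nonempty r) (Seq (compile p) (Pop r))"

primrec writes :: "prog \<Rightarrow> nat set" where
  "writes PSkip = {}"
| "writes (PPush r b) = {r}"
| "writes (PPop r) = {r}"
| "writes (PQuery r) = {r}"
| "writes (p ;; q) = writes p \<union> writes q"
| "writes (PCond b p q) = writes p \<union> writes q"
| "writes (For r p) = insert r (writes p)"

text \<open>
  Register 1 initially holds program data of unbounded length, while running times must be bounded
  in terms of register 0 alone; hence the length of register 1 must not control a loop or a query.
\<close>

primrec tame :: "prog \<Rightarrow> bool" where
  "tame PSkip \<longleftrightarrow> True"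
| "tame (PPush r b) \<longleftrightarrow> True"
| "tame (PPop r) \<longleftrightarrow> True"
| "tame (PQuery r) \<longleftrightarrow> r \<noteq> 1"
| "tame (p ;; q) \<longleftrightarrow> tame p \<and> tame q"
| "tame (PCond b p q) \<longleftrightarrow> tame p \<and> tame q"
| "tame (For r p) \<longleftrightarrow> r \<noteq> 1 \<and> r \<notin> writes p \<and> tame p"

lemma sem_unwritten: "r \<notin> writes p \<Longrightarrow> sem Or p s r = s r"
proof (induction p arbitrary: s)
  case (For q p)
  have "((\<lambda>s. (sem Or p s)(q := tl (sem Or p s q))) ^^ n) s r = s r" for n
    using For by (induction n) auto
  then show ?case by simp
qed auto

abbreviation clear :: "nat \<Rightarrow> prog" where
  "clear r \<equiv> For r PSkip"

abbreviation move :: "nat \<Rightarrow> nat \<Rightarrow> prog" where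
  "move r q \<equiv> For r (PPush q True)"

abbreviation move2 :: "nat \<Rightarrow> nat \<Rightarrow> nat \<Rightarrow> prog" where
  "move2 r q q' \<equiv> For r (PPush q True ;; PPush q' True)"

lemma sem_clear: "sem Or (clear r) s = s(r := [])"
proof -
  have "((\<lambda>s. s(r := tl (s r))) ^^ n) s = s(r := drop n (s r))" for n
    by (induction n) (auto simp: fun_eq_iff drop_Suc tl_drop)
  then show ?thesis by simp
qed

lemma sem_move:
  assumes "r \<noteq> q"
  shows "sem Or (move r q) s = s(r := [], q := replicate (length (s r)) True @ s q)"
proof -
  have "((\<lambda>s. (sem Or (PPush q True) s)(r := tl (sem Or (PPush q True) s r))) ^^ n) s
      = s(r := drop n (s r), q := replicate n True @ s q)" for n
    using assms by (induction n) (auto simp: fun_eq_iff drop_Suc tl_drop)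
  then show ?thesis by simp
qed

lemma sem_move2:
  assumes "r \<noteq> q" "r \<noteq> q'" "q \<noteq> q'"
  shows "sem Or (move2 r q q') s =
    s(r := [], q := replicate (length (s r)) True @ s q, q' := replicate (length (s r)) True @ s q')"
proof -
  have "((\<lambda>s. (sem Or (PPush q True ;; PPush q' True) s)
          (r := tl (sem Or (PPush q True ;; PPush q' True) s r))) ^^ n) s
      = s(r := drop n (s r), q := replicate n True @ s q, q' := replicate n True @ s q')" for n
    using assms by (induction n) (auto simp: fun_eq_iff drop_Suc tl_drop)
  then show ?thesis by simp
qed

lemma sem_pops:
  assumes "r \<noteq> q"
  shows "sem Or (For r (PPop q)) s = s(r := [], q := drop (length (s r)) (s q))"
proof -
  have "((\<lambda>s. (sem Or (PPop q) s)(r := tl (sem Or (PPop q) s r))) ^^ n) s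
      = s(r := drop n (s r), q := drop n (s q))" for n
    using assms by (induction n) (auto simp: fun_eq_iff drop_Suc tl_drop)
  then show ?thesis by simp
qed

section \<open>Functions computed by loop programs\<close>

text \<open>
  Only the length of a register counts as its value. The variables of an environment \<open>e\<close> are the
  functions in \<open>V\<close>; they sit in the registers \<open>rs\<close>, and everything from register \<open>K\<close> on is
  work space, with the result left in \<open>K\<close>.
\<close>

definition computes ::
    "(nat \<Rightarrow> bool list) \<Rightarrow> ('e \<Rightarrow> nat) list \<Rightarrow> ('e \<Rightarrow> nat) \<Rightarrow> nat list \<Rightarrow> nat \<Rightarrow> prog \<Rightarrow> bool" where
  "computes Or V F rs K p \<longleftrightarrow> tame p \<and> writes p \<subseteq> set rs \<union> {K..} \<and>
     (\<forall>s e. map (\<lambda>r. length (s r)) rs = map (\<lambda>v. v e) V \<longrightarrow>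
        map (\<lambda>r. length (sem Or p s r)) rs = map (\<lambda>v. v e) V \<and> length (sem Or p s K) = F e)"

text \<open>Requiring a program for every register layout allows subprograms to be placed above
  intermediate results, which they then preserve. Register 1 stays out of the layout because its
  length must not control loops.\<close>

definition cmp :: "(nat \<Rightarrow> bool list) \<Rightarrow> ('e \<Rightarrow> nat) list \<Rightarrow> ('e \<Rightarrow> nat) \<Rightarrow> bool" where
  "cmp Or V F \<longleftrightarrow> (\<forall>rs K. length rs = length V \<longrightarrow> 1 \<notin> set rs \<longrightarrow> (\<forall>r\<in>set rs. r < K) \<longrightarrow> 1 < K \<longrightarrow>
     (\<exists>p. computes Or V F rs K p))"

text \<open>Serves the bodies of recursions and bounded quantifiers: the old environment is paired
  with a new variable \<open>snd\<close>, whose register comes last.\<close>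

definition ext :: "('e \<Rightarrow> nat) list \<Rightarrow> ('e \<times> nat \<Rightarrow> nat) list" where
  "ext V = map (\<lambda>v p. v (fst p)) V @ [snd]"

section \<open>Closure of computed functions under basic operations, queries and recursion\<close>

lemma cmpI:
  assumes "\<And>rs K. length rs = length V \<Longrightarrow> 1 \<notin> set rs \<Longrightarrow> (\<And>r. r \<in> set rs \<Longrightarrow> r < K) \<Longrightarrow> 1 < K \<Longrightarrow>
     \<exists>p. computes Or V F rs K p"
  shows "cmp Or V F"
  using assms unfolding cmp_def by blast

lemma cmpE:
  assumes "cmp Or V F" "length rs = length V" "1 \<notin> set rs" "\<And>r. r \<in> set rs \<Longrightarrow> r < K" "1 < K"
  obtains p where "tame p" "writes p \<subseteq> set rs \<union> {K..}"
    "\<And>s e. map (\<lambda>r. length (s r)) rs = map (\<lambda>v. v e) V \<Longrightarrow>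
      map (\<lambda>r. length (sem Or p s r)) rs = map (\<lambda>v. v e) V"
    "\<And>s e. map (\<lambda>r. length (s r)) rs = map (\<lambda>v. v e) V \<Longrightarrow> length (sem Or p s K) = F e"
  using assms unfolding cmp_def computes_def by metis

lemma map_length_upd:
  fixes K :: nat
  assumes "\<And>r. r \<in> set rs \<Longrightarrow> r < K"
  shows "map (\<lambda>r. length ((s(K := u)) r)) rs = map (\<lambda>r. length (s r)) rs"
  using assms by fastforce

lemma map_length_eqI:
  fixes K :: nat
  assumes "map (\<lambda>r. length (s r)) rs = l" "\<And>r. r \<in> set rs \<Longrightarrow> r < K"
    and "\<And>r. r < K \<Longrightarrow> length (s' r) = length (s r)"
  shows "map (\<lambda>r. length (s' r)) rs = l"
  using assms by fastforce

text \<open>A register can only be copied by emptying it, so its length is transferred to two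
  registers and restored from one of them. The bits are lost, but only lengths count.\<close>

lemma cmp_var:
  assumes "F \<in> set V"
  shows "cmp Or V F"
proof (rule cmpI)
  fix rs :: "nat list" and K :: nat
  assume rs: "length rs = length V" "1 \<notin> set rs" "\<And>r. r \<in> set rs \<Longrightarrow> r < K" "1 < K"
  from assms obtain i where i: "i < length V" "F = V ! i" by (metis in_set_conv_nth)
  define r where "r = rs ! i"
  have r: "r \<in> set rs" "r < K" "r \<noteq> 1" using i rs unfolding r_def by (auto, metis nth_mem)
  define p where "p = clear K ;; clear (Suc K) ;; move2 r K (Suc K) ;; move (Suc K) r"
  have sem: "sem Or p s = s(K := replicate (length (s r)) True, Suc K := [],
      r := replicate (length (s r)) True)" for s
    unfolding p_def sem.simps(5)
    using r by (auto simp: sem_clear sem_move sem_move2 fun_eq_iff simp del: sem.simps)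
  have "computes Or V F rs K p" unfolding computes_def
  proof (intro conjI allI impI)
    show "tame p" "writes p \<subseteq> set rs \<union> {K..}"
      using r rs(3)[of "Suc K"] rs(4) unfolding p_def by auto
  next
    fix s :: state and e assume s: "map (\<lambda>r. length (s r)) rs = map (\<lambda>v. v e) V"
    have "length (sem Or p s q) = length (s q)" if "q < K" for q
      using that unfolding sem by auto
    from s rs(3) this show "map (\<lambda>r. length (sem Or p s r)) rs = map (\<lambda>v. v e) V"
      by (rule map_length_eqI)
    have "length (s r) = F e" using arg_cong[OF s, of "\<lambda>l. l ! i"] i rs(1) by (simp add: r_def)
    then show "length (sem Or p s K) = F e" unfolding sem using r by simp
  qed
  then show "\<exists>p. computes Or V F rs K p" ..
qed

lemma cmp_weaken:
  assumes "cmp Or V F"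
  shows "cmp Or (ext V) (\<lambda>p. F (fst p))"
proof (rule cmpI)
  fix rs :: "nat list" and K :: nat
  assume rs: "length rs = length (ext V)" "1 \<notin> set rs" "\<And>r. r \<in> set rs \<Longrightarrow> r < K" "1 < K"
  then obtain rs' r where rs': "rs = rs' @ [r]" "length rs' = length V"
    by (cases rs rule: rev_cases) (auto simp: ext_def)
  from cmpE[OF assms, of rs' K] obtain p where p: "tame p" "writes p \<subseteq> set rs' \<union> {K..}"
    "\<And>s e. map (\<lambda>r. length (s r)) rs' = map (\<lambda>v. v e) V \<Longrightarrow>
      map (\<lambda>r. length (sem Or p s r)) rs' = map (\<lambda>v. v e) V"
    "\<And>s e. map (\<lambda>r. length (s r)) rs' = map (\<lambda>v. v e) V \<Longrightarrow> length (sem Or p s K) = F e"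
    using rs rs' by auto
  have "length (sem Or p s r) = length (s r)"
    if "map (\<lambda>r. length (s r)) rs' = map (\<lambda>v. v e) V" for s e
  proof (cases "r \<in> set rs'")
    case True
    then show ?thesis using p(3)[OF that] that by (metis (no_types, lifting) map_eq_conv)
  next
    case False
    then have "r \<notin> writes p" using p(2) rs(3)[of r] rs' by auto
    then show ?thesis by (simp add: sem_unwritten)
  qed
  with p have "computes Or (ext V) (\<lambda>p. F (fst p)) rs K p"
    unfolding computes_def ext_def rs'(1) by (auto simp: comp_def)
  then show "\<exists>p. computes Or (ext V) (\<lambda>p. F (fst p)) rs K p" ..
qed

lemma cmp_zero: "cmp Or V (\<lambda>e. 0)"
proof (rule cmpI)
  fix rs :: "nat list" and K :: nat
  assume rs: "length rs = length V" "1 \<notin> set rs" "\<And>r. r \<in> set rs \<Longrightarrow> r < K" "1 < K"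
  have "computes Or V (\<lambda>e. 0) rs K (clear K)"
    unfolding computes_def sem_clear using rs(4)
    by (simp add: map_length_upd[OF rs(3)] del: fun_upd_apply) simp
  then show "\<exists>p. computes Or V (\<lambda>e. 0) rs K p" ..
qed

lemma cmp_Suc:
  assumes "cmp Or V F"
  shows "cmp Or V (\<lambda>e. Suc (F e))"
proof (rule cmpI)
  fix rs :: "nat list" and K :: nat
  assume rs: "length rs = length V" "1 \<notin> set rs" "\<And>r. r \<in> set rs \<Longrightarrow> r < K" "1 < K"
  from cmpE[OF assms this] obtain p where p: "tame p" "writes p \<subseteq> set rs \<union> {K..}"
    "\<And>s e. map (\<lambda>r. length (s r)) rs = map (\<lambda>v. v e) V \<Longrightarrow>
      map (\<lambda>r. length (sem Or p s r)) rs = map (\<lambda>v. v e) V"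
    "\<And>s e. map (\<lambda>r. length (s r)) rs = map (\<lambda>v. v e) V \<Longrightarrow> length (sem Or p s K) = F e"
    by metis
  from p have "computes Or V (\<lambda>e. Suc (F e)) rs K (p ;; PPush K True)"
    unfolding computes_def by (simp add: map_length_upd[OF rs(3)] del: fun_upd_apply) simp
  then show "\<exists>p. computes Or V (\<lambda>e. Suc (F e)) rs K p" ..
qed

lemma cmp_apply:
  assumes "cmp Or [\<lambda>n. n] g" "cmp Or V F"
  shows "cmp Or V (\<lambda>e. g (F e))"
proof (rule cmpI)
  fix rs :: "nat list" and K :: nat
  assume rs: "length rs = length V" "1 \<notin> set rs" "\<And>r. r \<in> set rs \<Longrightarrow> r < K" "1 < K"
  from cmpE[OF assms(2) this] obtain p where p: "tame p" "writes p \<subseteq> set rs \<union> {K..}"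
    "\<And>s e. map (\<lambda>r. length (s r)) rs = map (\<lambda>v. v e) V \<Longrightarrow>
      map (\<lambda>r. length (sem Or p s r)) rs = map (\<lambda>v. v e) V"
    "\<And>s e. map (\<lambda>r. length (s r)) rs = map (\<lambda>v. v e) V \<Longrightarrow> length (sem Or p s K) = F e"
    by metis
  from cmpE[OF assms(1), of "[K]" "Suc K"] rs(4) obtain q where
    q: "tame q" "writes q \<subseteq> set [K] \<union> {Suc K..}"
    "\<And>s. length (sem Or q s (Suc K)) = g (length (s K))"
    by simp metis
  define P where "P = p ;; q ;; clear K ;; move (Suc K) K"
  have "computes Or V (\<lambda>e. g (F e)) rs K P" unfolding computes_def
  proof (intro conjI allI impI)
    show "tame P" "writes P \<subseteq> set rs \<union> {K..}" using p(1,2) q(1,2) rs(4) unfolding P_def by auto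
  next
    fix s :: state and e assume s: "map (\<lambda>r. length (s r)) rs = map (\<lambda>v. v e) V"
    have eq: "sem Or P s r = sem Or p s r" if "r < K" for r
    proof -
      have "r \<notin> writes (q ;; clear K ;; move (Suc K) K)" using q(2) that by auto
      then show ?thesis unfolding P_def sem.simps(5)[of _ p] by (rule sem_unwritten)
    qed
    show "map (\<lambda>r. length (sem Or P s r)) rs = map (\<lambda>v. v e) V"
      by (rule map_length_eqI[OF p(3)[OF s] rs(3)]) (simp_all add: eq)
    show "length (sem Or P s K) = g (F e)"
      unfolding P_def sem.simps(5)
      by (subst sem_move) (simp_all add: sem_clear q p(4)[OF s] del: sem.simps)
  qed
  then show "\<exists>p. computes Or V (\<lambda>e. g (F e)) rs K p" ..
qed

lemma cmp_oracle:
  assumes "cmp Or V M" "cmp Or V I"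
  shows "cmp Or V (\<lambda>e. of_bool (I e < length (Or (M e)) \<and> Or (M e) ! I e))"
proof (rule cmpI)
  fix rs :: "nat list" and K :: nat
  assume rs: "length rs = length V" "1 \<notin> set rs" "\<And>r. r \<in> set rs \<Longrightarrow> r < K" "1 < K"
  from cmpE[OF assms(1) this] obtain p where p: "tame p" "writes p \<subseteq> set rs \<union> {K..}"
    "\<And>s e. map (\<lambda>r. length (s r)) rs = map (\<lambda>v. v e) V \<Longrightarrow>
      map (\<lambda>r. length (sem Or p s r)) rs = map (\<lambda>v. v e) V"
    "\<And>s e. map (\<lambda>r. length (s r)) rs = map (\<lambda>v. v e) V \<Longrightarrow> length (sem Or p s K) = M e"
    by metis
  from cmpE[OF assms(2) rs(1,2), of "Suc K"] rs(3,4) obtain q where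
    q: "tame q" "writes q \<subseteq> set rs \<union> {Suc K..}"
    "\<And>s e. map (\<lambda>r. length (s r)) rs = map (\<lambda>v. v e) V \<Longrightarrow>
      map (\<lambda>r. length (sem Or q s r)) rs = map (\<lambda>v. v e) V"
    "\<And>s e. map (\<lambda>r. length (s r)) rs = map (\<lambda>v. v e) V \<Longrightarrow> length (sem Or q s (Suc K)) = I e"
    by (metis less_SucI)
  \<comment> \<open>The query replaces register \<open>K\<close> by the answer of the oracle, and
    popping \<open>I e\<close> bits brings the wanted bit to the top. Past the end the stack is
    empty, so \<open>Top\<close> fails and the result is 0.\<close>
  define R where "R = PQuery K ;; For (Suc K) (PPop K) ;;
    PCond (Top K) (clear K ;; PPush K True) (clear K)"
  define P where "P = p ;; q ;; R"
  have K: "K \<notin> writes q" using q(2) rs(3) by fastforce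
  have "computes Or V (\<lambda>e. of_bool (I e < length (Or (M e)) \<and> Or (M e) ! I e)) rs K P"
    unfolding computes_def
  proof (intro conjI allI impI)
    show "tame P" "writes P \<subseteq> set rs \<union> {K..}"
      using p(1,2) q(1,2) rs(4) unfolding P_def R_def by auto
  next
    fix s :: state and e assume s: "map (\<lambda>r. length (s r)) rs = map (\<lambda>v. v e) V"
    let ?s = "sem Or q (sem Or p s)"
    note s1 = p(3)[OF s] and s2 = q(3)[OF p(3)[OF s]]
    have eq: "sem Or P s r = ?s r" if "r < K" for r
    proof -
      have "r \<notin> writes R" using that by (auto simp: R_def)
      then show ?thesis unfolding P_def sem.simps(5) by (rule sem_unwritten)
    qed
    show "map (\<lambda>r. length (sem Or P s r)) rs = map (\<lambda>v. v e) V"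
      by (rule map_length_eqI[OF s2 rs(3)]) (simp_all add: eq)
    have "length (?s (Suc K)) = I e" "length (?s K) = M e"
      using q(4)[OF s1] p(4)[OF s] K by (simp_all add: sem_unwritten)
    then have "sem Or (For (Suc K) (PPop K)) (sem Or (PQuery K) ?s) =
        ?s(Suc K := [], K := drop (I e) (Or (M e)))"
      by (subst sem_pops) (auto simp: fun_eq_iff)
    then show "length (sem Or P s K) = of_bool (I e < length (Or (M e)) \<and> Or (M e) ! I e)"
      unfolding P_def R_def sem.simps(5,6)
      by (auto simp: sem_clear hd_drop_conv_nth simp del: sem.simps(4,7))
  qed
  then show "\<exists>p. computes Or V (\<lambda>e. of_bool (I e < length (Or (M e)) \<and> Or (M e) ! I e)) rs K p" ..
qed

text \<open>Register \<open>K\<close> counts the remaining rounds, \<open>K + 1\<close> the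
  completed ones, \<open>K + 2\<close> holds the accumulator, and the step \<open>h\<close> leaves
  its new value in \<open>K + 3\<close>.\<close>

lemma cmp_rec:
  assumes "cmp Or V B" "cmp Or V N"
    and "cmp Or (ext (ext V)) (\<lambda>p. H (fst (fst p)) (snd (fst p)) (snd p))"
  shows "cmp Or V (\<lambda>e. rec_nat (B e) (H e) (N e))"
proof (rule cmpI)
  fix rs :: "nat list" and K :: nat
  assume rs: "length rs = length V" "1 \<notin> set rs" "\<And>r. r \<in> set rs \<Longrightarrow> r < K" "1 < K"
  from cmpE[OF assms(2) this] obtain p where p: "tame p" "writes p \<subseteq> set rs \<union> {K..}"
    "\<And>s e. map (\<lambda>r. length (s r)) rs = map (\<lambda>v. v e) V \<Longrightarrow>
      map (\<lambda>r. length (sem Or p s r)) rs = map (\<lambda>v. v e) V"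
    "\<And>s e. map (\<lambda>r. length (s r)) rs = map (\<lambda>v. v e) V \<Longrightarrow> length (sem Or p s K) = N e"
    by metis
  from cmpE[OF assms(1) rs(1,2), of "K + 2"] rs(3,4) obtain q where
    q: "tame q" "writes q \<subseteq> set rs \<union> {K + 2..}"
    "\<And>s e. map (\<lambda>r. length (s r)) rs = map (\<lambda>v. v e) V \<Longrightarrow>
      map (\<lambda>r. length (sem Or q s r)) rs = map (\<lambda>v. v e) V"
    "\<And>s e. map (\<lambda>r. length (s r)) rs = map (\<lambda>v. v e) V \<Longrightarrow> length (sem Or q s (K + 2)) = B e"
    by (metis trans_less_add1)
  have rs3: "r < K + 3" if "r \<in> set (rs @ [K + 1, K + 2])" for r
    using that rs(3)[of r] by auto
  have rs': "length (rs @ [K + 1, K + 2]) = length (ext (ext V))"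
      "1 \<notin> set (rs @ [K + 1, K + 2])" "1 < K + 3"
    using rs(1,2,4) by (auto simp: ext_def)
  from cmpE[OF assms(3) rs'(1,2) rs3 rs'(3)] obtain h where
    h: "tame h" "writes h \<subseteq> set (rs @ [K + 1, K + 2]) \<union> {K + 3..}"
    "\<And>s e. map (\<lambda>r. length (s r)) (rs @ [K + 1, K + 2]) = map (\<lambda>v. v e) (ext (ext V)) \<Longrightarrow>
      map (\<lambda>r. length (sem Or h s r)) (rs @ [K + 1, K + 2]) = map (\<lambda>v. v e) (ext (ext V))"
    "\<And>s e. map (\<lambda>r. length (s r)) (rs @ [K + 1, K + 2]) = map (\<lambda>v. v e) (ext (ext V)) \<Longrightarrow>
      length (sem Or h s (K + 3)) = H (fst (fst e)) (snd (fst e)) (snd e)"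
    by metis
  define b where "b = h ;; clear (K + 2) ;; move (K + 3) (K + 2) ;; PPush (K + 1) True"
  define P where "P = p ;; q ;; clear (K + 1) ;; For K b ;; move (K + 2) K"
  have K: "K \<notin> writes q" "K \<notin> writes b" using q(2) h(2) rs(3) unfolding b_def by force+
  have "computes Or V (\<lambda>e. rec_nat (B e) (H e) (N e)) rs K P"
    unfolding computes_def
  proof (intro conjI allI impI)
    show "tame P" "writes P \<subseteq> set rs \<union> {K..}"
      using p(1,2) q(1,2) h(1,2) rs(4) K unfolding P_def b_def by auto
  next
    fix s :: state and e assume s: "map (\<lambda>r. length (s r)) rs = map (\<lambda>v. v e) V"
    define s3 where "s3 = (sem Or q (sem Or p s))(K + 1 := [])"
    note s1 = p(3)[OF s] and s2 = q(3)[OF p(3)[OF s]]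
    have s3: "map (\<lambda>r. length (s3 r)) rs = map (\<lambda>v. v e) V"
      by (rule map_length_eqI[OF s2 rs(3)]) (simp_all add: s3_def)
    have s3K: "length (s3 K) = N e" "s3 (K + 1) = []" "length (s3 (K + 2)) = B e"
      using p(4)[OF s] q(4)[OF s1] K by (simp_all add: s3_def sem_unwritten)
    define st where "st = (\<lambda>s::state. (sem Or b s)(K := tl (sem Or b s K)))"
    have inv: "map (\<lambda>r. length ((st ^^ i) s3 r)) rs = map (\<lambda>v. v e) V \<and>
        length ((st ^^ i) s3 (K + 1)) = i \<and>
        length ((st ^^ i) s3 (K + 2)) = rec_nat (B e) (H e) i" for i
    proof (induction i)
      case 0
      then show ?case using s3 s3K by simp
    next
      case (Suc i)
      define u where "u = (st ^^ i) s3"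
      note IH = Suc.IH[folded u_def]
      have fit: "map (\<lambda>r. length (u r)) (rs @ [K + 1, K + 2]) =
          map (\<lambda>v. v ((e, i), rec_nat (B e) (H e) i)) (ext (ext V))"
        using IH by (simp add: ext_def)
      have u: "map (\<lambda>r. length (sem Or h u r)) rs = map (\<lambda>v. v e) V"
        "length (sem Or h u (K + 1)) = i"
        "length (sem Or h u (K + 3)) = rec_nat (B e) (H e) (Suc i)"
        using h(3)[OF fit] h(4)[OF fit] by (simp_all add: ext_def comp_def)
      have semb: "sem Or b u = (sem Or h u)(K + 3 := [],
          K + 2 := replicate (length (sem Or h u (K + 3))) True,
          K + 1 := True # sem Or h u (K + 1))"
        unfolding b_def sem.simps(5)
        by (subst sem_move) (auto simp: sem_clear fun_eq_iff simp del: sem.simps(7))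
      have "map (\<lambda>r. length (st u r)) rs = map (\<lambda>v. v e) V"
        by (rule map_length_eqI[OF u(1) rs(3)]) (simp_all add: st_def semb)
      moreover have "length (st u (K + 1)) = Suc i"
        "length (st u (K + 2)) = rec_nat (B e) (H e) (Suc i)"
        using u(2,3) by (simp_all add: st_def semb)
      ultimately show ?case by (simp add: u_def)
    qed
    define s4 where "s4 = (st ^^ N e) s3"
    have s4: "sem Or (For K b) s3 = s4"
      by (simp add: s4_def st_def s3K)
    have semP: "sem Or P s = s4(K + 2 := [], K := replicate (length (s4 (K + 2))) True @ s4 K)"
      unfolding P_def sem.simps(5) sem_clear s3_def[symmetric] s4
      by (subst sem_move) (auto simp: fun_eq_iff)
    \<comment> \<open>The loop has used up register \<open>K\<close>, so the final
      \<open>move\<close> leaves exactly the accumulator there.\<close>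
    have K4: "s4 K = []"
    proof -
      have "(st ^^ i) s3 K = drop i (s3 K)" for i
        using K(2) by (induction i) (simp_all add: st_def sem_unwritten drop_Suc tl_drop)
      then show ?thesis using s3K by (simp add: s4_def)
    qed
    show "map (\<lambda>r. length (sem Or P s r)) rs = map (\<lambda>v. v e) V"
      by (rule map_length_eqI[OF _ rs(3)])
        (use inv[of "N e", folded s4_def] in \<open>simp_all add: semP\<close>)
    show "length (sem Or P s K) = rec_nat (B e) (H e) (N e)"
      using inv[of "N e", folded s4_def] by (simp add: semP K4)
  qed
  then show "\<exists>p. computes Or V (\<lambda>e. rec_nat (B e) (H e) (N e)) rs K p" ..
qed

section \<open>Arithmetic, logic and bounded quantifiers by primitive recursion\<close>

lemma cmp_const: "cmp Or V (\<lambda>e. n)"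
  by (induction n) (simp_all add: cmp_zero cmp_Suc)

lemma cmp_ext_snd: "cmp Or (ext V) snd"
  by (rule cmp_var) (simp add: ext_def)

lemma cmp_plus:
  assumes "cmp Or V F" "cmp Or V G"
  shows "cmp Or V (\<lambda>e. F e + G e)"
proof -
  have "rec_nat a (\<lambda>_. Suc) b = a + b" for a b
    by (induction b) simp_all
  with cmp_rec[where H = "\<lambda>_ _. Suc", OF assms cmp_Suc[OF cmp_ext_snd]] show ?thesis by simp
qed

lemma cmp_pred:
  assumes "cmp Or V F"
  shows "cmp Or V (\<lambda>e. F e - 1)"
proof -
  have "rec_nat 0 (\<lambda>k _. k) b = b - 1" for b :: nat
    by (cases b) simp_all
  with cmp_rec[where H = "\<lambda>_ k _. k", OF cmp_zero assms cmp_weaken[OF cmp_ext_snd]]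
  show ?thesis by simp
qed

lemma cmp_minus:
  assumes "cmp Or V F" "cmp Or V G"
  shows "cmp Or V (\<lambda>e. F e - G e)"
proof -
  have "rec_nat a (\<lambda>_ c. c - 1) b = a - b" for a b :: nat
    by (induction b) simp_all
  with cmp_rec[where H = "\<lambda>_ _ c. c - 1", OF assms cmp_pred[OF cmp_ext_snd]]
  show ?thesis by simp
qed

lemma cmp_times:
  assumes "cmp Or V F" "cmp Or V G"
  shows "cmp Or V (\<lambda>e. F e * G e)"
proof -
  have "rec_nat 0 (\<lambda>_ c. c + a) b = a * b" for a b :: nat
    by (induction b) simp_all
  with cmp_rec[where H = "\<lambda>e _ c. c + F e", OF cmp_zero assms(2)
    cmp_plus[OF cmp_ext_snd cmp_weaken[OF cmp_weaken[OF assms(1)]]]] show ?thesis by simp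
qed

lemma cmp_power2:
  assumes "cmp Or V F"
  shows "cmp Or V (\<lambda>e. 2 ^ F e)"
proof -
  have "rec_nat 1 (\<lambda>_ c. c + c) b = (2 ^ b :: nat)" for b
    by (induction b) simp_all
  with cmp_rec[where H = "\<lambda>_ _ c. c + c" and B = "\<lambda>_. 1", OF cmp_const assms
    cmp_plus[OF cmp_ext_snd cmp_ext_snd]] show ?thesis by simp
qed

lemma cmp_eq0:
  assumes "cmp Or V F"
  shows "cmp Or V (\<lambda>e. of_bool (F e = 0))"
proof -
  have "1 - a = of_bool (a = 0)" for a :: nat
    by (cases a) simp_all
  with cmp_minus[OF cmp_const assms, of 1] show ?thesis by simp
qed

lemma cmp_not:
  assumes "cmp Or V (\<lambda>e. of_bool (P e))"
  shows "cmp Or V (\<lambda>e. of_bool (\<not> P e))"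
  using cmp_eq0[OF assms] by simp

lemma cmp_conj:
  assumes "cmp Or V (\<lambda>e. of_bool (P e))" "cmp Or V (\<lambda>e. of_bool (Q e))"
  shows "cmp Or V (\<lambda>e. of_bool (P e \<and> Q e))"
  using cmp_times[OF assms] by (simp only: of_bool_conj)

lemma cmp_imp:
  assumes "cmp Or V (\<lambda>e. of_bool (P e))" "cmp Or V (\<lambda>e. of_bool (Q e))"
  shows "cmp Or V (\<lambda>e. of_bool (P e \<longrightarrow> Q e))"
  using cmp_not[OF cmp_conj[OF assms(1) cmp_not[OF assms(2)]]] by simp

lemma cmp_iff:
  assumes "cmp Or V (\<lambda>e. of_bool (P e))" "cmp Or V (\<lambda>e. of_bool (Q e))"
  shows "cmp Or V (\<lambda>e. of_bool (P e \<longleftrightarrow> Q e))"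
  using cmp_conj[OF cmp_imp[OF assms] cmp_imp[OF assms(2,1)]]
  by (simp only: iff_conv_conj_imp)

lemma cmp_eq:
  fixes F G :: "'e \<Rightarrow> nat"
  assumes "cmp Or V F" "cmp Or V G"
  shows "cmp Or V (\<lambda>e. of_bool (F e = G e))"
proof -
  have "(a - b) + (b - a) = 0 \<longleftrightarrow> a = b" for a b :: nat
    by auto
  with cmp_eq0[OF cmp_plus[OF cmp_minus[OF assms] cmp_minus[OF assms(2,1)]]]
  show ?thesis by simp
qed

text \<open>The recursion counts the witnesses below \<open>N e\<close>, and the count is compared
  with 0.\<close>

lemma cmp_bex:
  assumes "cmp Or V N" "cmp Or (ext V) (\<lambda>p. of_bool (P (fst p) (snd p)))"
  shows "cmp Or V (\<lambda>e. of_bool (\<exists>i<N e. P e i))"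
proof -
  define H where "H e k c = c + of_bool (P e k)" for e k and c :: nat
  have "rec_nat 0 (H e) b = 0 \<longleftrightarrow> \<not> (\<exists>i<b. P e i)" for b e
    by (induction b) (auto simp: H_def less_Suc_eq)
  moreover have "cmp Or (ext (ext V)) (\<lambda>p. H (fst (fst p)) (snd (fst p)) (snd p))"
    unfolding H_def by (rule cmp_plus[OF cmp_ext_snd cmp_weaken[OF assms(2)]])
  ultimately show ?thesis
    using cmp_not[OF cmp_eq0[OF cmp_rec[OF cmp_zero assms(1), of H]]] by simp
qed

lemma cmp_ball:
  assumes "cmp Or V N" "cmp Or (ext V) (\<lambda>p. of_bool (P (fst p) (snd p)))"
  shows "cmp Or V (\<lambda>e. of_bool (\<forall>i<N e. P e i))"
  using cmp_not[OF cmp_bex[OF assms(1) cmp_not[OF assms(2)]]] by simp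

text \<open>Bounded quantifiers, sums, products and powers suffice to read a bit of a number, so
  that neither division nor parity has to be programmed.\<close>

lemma odd_div_power2_iff:
  fixes a j :: nat
  shows "odd (a div 2 ^ j) \<longleftrightarrow> (\<exists>q<Suc a. \<exists>r<2 ^ j. a = (2 * q + 1) * 2 ^ j + r)"
proof
  assume "odd (a div 2 ^ j)"
  then obtain q where q: "a div 2 ^ j = 2 * q + 1" by (auto elim: oddE)
  have "a = (2 * q + 1) * 2 ^ j + a mod 2 ^ j" by (metis q div_mult_mod_eq)
  moreover have "q < Suc a" using q div_le_dividend[of a "2 ^ j"] by linarith
  ultimately show "\<exists>q<Suc a. \<exists>r<2 ^ j. a = (2 * q + 1) * 2 ^ j + r"
    by (metis mod_less_divisor zero_less_numeral zero_less_power)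
next
  assume "\<exists>q<Suc a. \<exists>r<2 ^ j. a = (2 * q + 1) * 2 ^ j + r"
  then obtain q r where "r < 2 ^ j" "a = (2 * q + 1) * 2 ^ j + r" by blast
  then have "a div 2 ^ j = 2 * q + 1" by (metis div_less div_mult_self3
        add.commute add_0_right power_not_zero zero_neq_numeral)
  then show "odd (a div 2 ^ j)" by simp
qed

lemma cmp_odd_div:
  assumes "cmp Or V F" "cmp Or V G"
  shows "cmp Or V (\<lambda>e. of_bool (odd (F e div 2 ^ G e)))"
  unfolding odd_div_power2_iff
  by (intro cmp_bex cmp_Suc cmp_eq cmp_plus cmp_times cmp_power2 cmp_const assms cmp_weaken
      cmp_ext_snd)

section \<open>Running times\<close>

text \<open>Monotone and inflationary, so that bounds of subprograms can be composed. The empty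
  oracle appears because a time bound must be computable outright, although the programs bounded by
  it query \<open>f\<close>.\<close>

definition gauge :: "(nat \<Rightarrow> nat) \<Rightarrow> bool" where
  "gauge g \<longleftrightarrow> mono g \<and> (\<forall>n. n \<le> g n) \<and> cmp (\<lambda>_. []) [\<lambda>n. n] g"

lemma gauge_comp: "gauge g \<Longrightarrow> gauge h \<Longrightarrow> gauge (\<lambda>n. g (h n))"
  unfolding gauge_def by (auto simp: mono_def intro: cmp_apply order_trans)

lemma gauge_Suc: "gauge g \<Longrightarrow> gauge (\<lambda>n. Suc (g n))"
  unfolding gauge_def by (auto simp: mono_def cmp_Suc le_SucI)

text \<open>\<open>4 ^ n\<close> is the length of the truth table at length \<open>n\<close>, the
  most that a query of a register of length at most \<open>n\<close> can write. It also pays for a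
  pushed bit, and the summand 1 pays for the step itself.\<close>

lemma gauge_query: "gauge (\<lambda>n. n + 4 ^ n + 1)"
proof -
  have "mono (\<lambda>n. n + 4 ^ n + 1 :: nat)"
    by (intro monoI add_mono) (auto intro: power_increasing)
  moreover have "cmp (\<lambda>_. []) [\<lambda>n. n] (\<lambda>n. n + 2 ^ (2 * n) + 1)"
    by (intro cmp_plus cmp_power2 cmp_times cmp_const cmp_var) simp_all
  ultimately show ?thesis unfolding gauge_def by (simp add: power_mult)
qed

lemma gauge_funpow_mono:
  assumes "gauge g" "a \<le> b" "i \<le> j"
  shows "(g ^^ i) a \<le> (g ^^ j) b"
proof -
  have "(g ^^ i) a \<le> (g ^^ i) b"
    using assms(1,2) by (simp add: gauge_def funpow_mono)
  also have "\<dots> \<le> (g ^^ (i + k)) b" for k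
    using assms(1) by (induction k) (auto simp: gauge_def intro: order_trans)
  from this[of "j - i"] have "(g ^^ i) b \<le> (g ^^ j) b" using assms(3) by simp
  finally show ?thesis .
qed

text \<open>Prepares the bound for a loop: its control register, hence its number of rounds, is at
  most the common bound \<open>n\<close>, and every round applies \<open>g\<close> once
  more.\<close>

lemma gauge_iterate:
  assumes "gauge g"
  shows "gauge (\<lambda>n. (g ^^ n) n)"
proof -
  have "mono (\<lambda>n. (g ^^ n) n)"
    by (intro monoI gauge_funpow_mono assms)
  moreover have "n \<le> (g ^^ n) n" for n
    using gauge_funpow_mono[OF assms, of n n 0 n] by simp
  moreover have rec: "rec_nat a (\<lambda>_. g) b = (g ^^ b) a" for a b
    by (induction b) simp_all
  have "cmp (\<lambda>_. []) [\<lambda>n. n] (\<lambda>n. rec_nat n (\<lambda>_. g) n)"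
    using assms unfolding gauge_def
    by (intro cmp_rec[where H = "\<lambda>_ _. g"] cmp_apply[OF _ cmp_ext_snd])
      (simp_all add: cmp_var)
  ultimately show ?thesis unfolding gauge_def rec by simp
qed

definition bounded_oracle :: "(nat \<Rightarrow> bool list) \<Rightarrow> bool" where
  "bounded_oracle Or \<longleftrightarrow> (\<forall>n. length (Or n) \<le> 4 ^ n)"

text \<open>
  The clock \<open>t\<close> is treated like one more register, so that \<open>g\<close> bounds sizes and time at once.
\<close>

definition bounds :: "(nat \<Rightarrow> bool list) \<Rightarrow> prog \<Rightarrow> (nat \<Rightarrow> nat) \<Rightarrow> bool" where
  "bounds Or p g \<longleftrightarrow> (\<forall>s t N. (\<forall>r. r \<noteq> 1 \<longrightarrow> length (s r) + t \<le> N) \<longrightarrow>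
    (\<exists>k. exec Or (compile p) s k (sem Or p s) \<and>
      (\<forall>r. r \<noteq> 1 \<longrightarrow> length (sem Or p s r) + (t + k) \<le> g N)))"

lemma boundsE:
  assumes "bounds Or p g" "\<And>r. r \<noteq> 1 \<Longrightarrow> length (s r) + t \<le> N"
  obtains k where "exec Or (compile p) s k (sem Or p s)"
    "\<And>r. r \<noteq> 1 \<Longrightarrow> length (sem Or p s r) + (t + k) \<le> g N"
proof -
  have "\<exists>k. exec Or (compile p) s k (sem Or p s) \<and>
      (\<forall>r. r \<noteq> 1 \<longrightarrow> length (sem Or p s r) + (t + k) \<le> g N)"
    using assms unfolding bounds_def by blast
  with that show thesis by blast
qed

lemma bounds_step:
  assumes "\<And>s. exec Or (compile p) s 1 (sem Or p s)"
    and "\<And>s r N. r \<noteq> 1 \<Longrightarrow> (\<And>q. q \<noteq> 1 \<Longrightarrow> length (s q) \<le> N) \<Longrightarrow>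
      length (sem Or p s r) \<le> length (s r) + 1 \<or> length (sem Or p s r) \<le> 4 ^ N"
  shows "bounds Or p (\<lambda>n. n + 4 ^ n + 1)"
  unfolding bounds_def
proof (intro allI impI exI[of _ 1] conjI assms(1))
  fix s :: state and t N and r :: nat
  assume s: "\<forall>r. r \<noteq> 1 \<longrightarrow> length (s r) + t \<le> N" and r: "r \<noteq> 1"
  have "length (s q) \<le> N" if "q \<noteq> 1" for q
    using s that add_leD1 by blast
  from assms(2)[of r s N, OF r this]
  have "length (sem Or p s r) \<le> length (s r) + 1 \<or> length (sem Or p s r) \<le> 4 ^ N" .
  moreover have "1 \<le> (4 :: nat) ^ N" by simp
  moreover have "length (s r) + t \<le> N" using s r by simp
  ultimately show "length (sem Or p s r) + (t + 1) \<le> N + 4 ^ N + 1" by linarith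
qed

lemma gauge_bounds:
  assumes "bounded_oracle Or" "tame p"
  shows "\<exists>g. gauge g \<and> bounds Or p g"
  using assms(2)
proof (induction p)
  case PSkip
  show ?case
    by (intro exI[of _ "\<lambda>n. n + 4 ^ n + 1"] conjI gauge_query bounds_step)
      (simp_all add: exec.Skip[unfolded One_nat_def])
next
  case (PPush r b)
  show ?case
    by (intro exI[of _ "\<lambda>n. n + 4 ^ n + 1"] conjI gauge_query bounds_step)
      (simp_all add: exec.Push[unfolded One_nat_def])
next
  case (PPop r)
  show ?case
    by (intro exI[of _ "\<lambda>n. n + 4 ^ n + 1"] conjI gauge_query bounds_step)
      (simp_all add: exec.Pop[unfolded One_nat_def] le_SucI)
next
  case (PQuery r)
  have "length (Or (length (s r))) \<le> 4 ^ N" if "length (s r) \<le> N" for s :: state and N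
    by (rule order_trans[of _ "4 ^ length (s r)"])
      (use assms(1) power_increasing[OF that, of "4 :: nat"] in \<open>simp_all add: bounded_oracle_def\<close>)
  with PQuery show ?case
    by (intro exI[of _ "\<lambda>n. n + 4 ^ n + 1"] conjI gauge_query bounds_step)
      (simp_all add: exec.Query[unfolded One_nat_def])
next
  case (PSeq p q)
  then obtain g h where g: "gauge g" "bounds Or p g" and h: "gauge h" "bounds Or q h" by auto
  show ?case
  proof (intro exI[of _ "\<lambda>n. h (g n)"] conjI, rule gauge_comp[OF h(1) g(1)],
      unfold bounds_def, intro allI impI)
    fix s :: state and t N assume s: "\<forall>r. r \<noteq> 1 \<longrightarrow> length (s r) + t \<le> N"
    obtain k where k: "exec Or (compile p) s k (sem Or p s)"
      "\<And>r. r \<noteq> 1 \<Longrightarrow> length (sem Or p s r) + (t + k) \<le> g N"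
      by (rule boundsE[OF g(2), of s t N]) (use s in blast)+
    obtain l where l:
      "exec Or (compile q) (sem Or p s) l (sem Or q (sem Or p s))"
      "\<And>r. r \<noteq> 1 \<Longrightarrow> length (sem Or q (sem Or p s) r) + (t + k + l) \<le> h (g N)"
      by (rule boundsE[OF h(2) k(2)]) blast+
    show "\<exists>k. exec Or (compile (p ;; q)) s k (sem Or (p ;; q) s) \<and>
        (\<forall>r. r \<noteq> 1 \<longrightarrow> length (sem Or (p ;; q) s r) + (t + k) \<le> h (g N))"
      using exec.Seq[OF k(1) l(1)] l(2) by (intro exI[of _ "k + l"]) (simp add: add.assoc)
  qed
next
  case (PCond b p q)
  then obtain g h where g: "gauge g" "bounds Or p g" and h: "gauge h" "bounds Or q h" by auto
  show ?case
  proof (intro exI[of _ "\<lambda>n. Suc (h (g n))"] conjI,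
      rule gauge_Suc[OF gauge_comp[OF h(1) g(1)]], unfold bounds_def, intro allI impI)
    fix s :: state and t N assume s: "\<forall>r. r \<noteq> 1 \<longrightarrow> length (s r) + t \<le> N"
    obtain k where k: "exec Or (compile p) s k (sem Or p s)"
      "\<And>r. r \<noteq> 1 \<Longrightarrow> length (sem Or p s r) + (t + k) \<le> g N"
      by (rule boundsE[OF g(2), of s t N]) (use s in blast)+
    obtain l where l: "exec Or (compile q) s l (sem Or q s)"
      "\<And>r. r \<noteq> 1 \<Longrightarrow> length (sem Or q s r) + (t + l) \<le> h N"
      by (rule boundsE[OF h(2), of s t N]) (use s in blast)+
    have "g N \<le> h (g N)" "h N \<le> h (g N)"
      using g(1) h(1) by (auto simp: gauge_def mono_def)
    then have k': "length (sem Or p s r) + (t + Suc k) \<le> Suc (h (g N))"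
      "length (sem Or q s r) + (t + Suc l) \<le> Suc (h (g N))" if "r \<noteq> 1" for r
      using k(2)[OF that] l(2)[OF that] by linarith+
    show "\<exists>k. exec Or (compile (PCond b p q)) s k (sem Or (PCond b p q) s) \<and>
        (\<forall>r. r \<noteq> 1 \<longrightarrow> length (sem Or (PCond b p q) s r) + (t + k) \<le> Suc (h (g N)))"
    proof (cases "holds b s")
      case True
      then show ?thesis using exec.CondTrue[OF True k(1)] k'
        by (intro exI[of _ "Suc k"]) simp
    next
      case False
      then show ?thesis using exec.CondFalse[OF False l(1)] k'
        by (intro exI[of _ "Suc l"]) simp
    qed
  qed
next
  case (For r p)
  then obtain g where g: "gauge g" "bounds Or p g" by auto
  have r: "r \<noteq> 1" "r \<notin> writes p" using For.prems by auto
  \<comment> \<open>The two extra steps of a round are the loop test and the \<open>Pop\<close>; the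
    failing last test is paid for by the outer \<open>Suc\<close>.\<close>
  define h where "h = (\<lambda>n. Suc (Suc (g n)))"
  have h: "gauge h" unfolding h_def by (intro gauge_Suc g(1))
  define st where "st = (\<lambda>s::state. (sem Or p s)(r := tl (sem Or p s r)))"
  have loop: "\<exists>k. exec Or (compile (For r p)) s k ((st ^^ n) s) \<and>
      (\<forall>q. q \<noteq> 1 \<longrightarrow> length ((st ^^ n) s q) + (t + k) \<le> Suc ((h ^^ n) N))"
    if "length (s r) = n" "\<And>q. q \<noteq> 1 \<Longrightarrow> length (s q) + t \<le> N" for s :: state and n t N
    using that
  proof (induction n arbitrary: s t N)
    case 0
    then show ?case by (intro exI[of _ 1]) (auto intro!: exec.WhileFalse[unfolded One_nat_def])
  next
    case (Suc n)
    obtain k where k: "exec Or (compile p) s k (sem Or p s)"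
      "\<And>q. q \<noteq> 1 \<Longrightarrow> length (sem Or p s q) + (t + k) \<le> g N"
      by (rule boundsE[OF g(2) Suc.prems(2)]) blast+
    have body: "exec Or (compile (p ;; PPop r)) s (k + 1) (st s)"
      using exec.Seq[OF k(1) exec.Pop] by (simp add: st_def)
    have "length (st s q) + (t + (k + 2)) \<le> h N" if "q \<noteq> 1" for q
      using k(2)[OF that] unfolding st_def h_def by (cases "q = r") auto
    moreover have "length (st s r) = n"
      using r Suc.prems(1) by (simp add: st_def sem_unwritten)
    ultimately obtain l where l: "exec Or (compile (For r p)) (st s) l ((st ^^ n) (st s))"
      "\<And>q. q \<noteq> 1 \<Longrightarrow> length ((st ^^ n) (st s) q) + (t + (k + 2) + l) \<le> Suc ((h ^^ n) (h N))"
      using Suc.IH[of "st s" "t + (k + 2)" "h N"] by (auto simp: add.assoc)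
    have "holds (Nonempty r) s" using Suc.prems(1) by auto
    from exec.WhileTrue[OF this body[unfolded compile.simps] l(1)[unfolded compile.simps]]
    have "exec Or (compile (For r p)) s (Suc (k + 1 + l)) ((st ^^ n) (st s))" by simp
    then show ?case
      using l(2) by (intro exI[of _ "k + 2 + l"]) (simp add: funpow_Suc_right add.assoc
        del: funpow.simps)
  qed
  show ?case
  proof (intro exI[of _ "\<lambda>n. Suc ((h ^^ n) n)"] conjI,
      rule gauge_Suc[OF gauge_iterate[OF h]], unfold bounds_def, intro allI impI)
    fix s :: state and t N assume s: "\<forall>r. r \<noteq> 1 \<longrightarrow> length (s r) + t \<le> N"
    \<comment> \<open>Since \<open>r\<close> is not register 1, the number of rounds is at most
      \<open>N\<close>; here unbounded data would destroy the time bound.\<close>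
    then have "(h ^^ length (s r)) N \<le> (h ^^ N) N"
      using r by (intro gauge_funpow_mono h) (auto intro: add_leD1)
    then have le: "Suc ((h ^^ length (s r)) N) \<le> Suc ((h ^^ N) N)" by simp
    have sem: "sem Or (For r p) s = (st ^^ length (s r)) s" by (simp add: st_def)
    from loop[OF refl, of s t N] s obtain k where
      "exec Or (compile (For r p)) s k (sem Or (For r p) s)"
      "\<forall>q. q \<noteq> 1 \<longrightarrow> length (sem Or (For r p) s q) + (t + k) \<le> Suc ((h ^^ length (s r)) N)"
      unfolding sem by blast
    with order_trans[OF _ le] show "\<exists>k. exec Or (compile (For r p)) s k (sem Or (For r p) s) \<and>
        (\<forall>q. q \<noteq> 1 \<longrightarrow> length (sem Or (For r p) s q) + (t + k) \<le> Suc ((h ^^ N) N))"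
      by blast
  qed
qed

lemma computable_gauge:
  assumes "gauge g"
  shows "computable g"
proof -
  have "cmp (\<lambda>_. []) [\<lambda>n. n] g" using assms by (simp add: gauge_def)
  then obtain p where p: "tame p" "\<And>s. length (sem (\<lambda>_. []) p s 2) = g (length (s 0))"
    by (rule cmpE[of _ _ _ "[0]" 2]) auto
  define P where "P = p ;; clear 0 ;; move 2 0"
  have "bounded_oracle (\<lambda>_. [])" "tame P" using p(1) by (auto simp: bounded_oracle_def P_def)
  from gauge_bounds[OF this] obtain h where h: "bounds (\<lambda>_. []) P h" by blast
  have "\<exists>k s. exec (\<lambda>_. []) (compile P) (initial (replicate n True) []) k s \<and>
      s 0 = replicate (g n) True" for n
  proof -
    let ?s = "initial (replicate n True) []"
    have "\<forall>r. r \<noteq> 1 \<longrightarrow> length (?s r) + 0 \<le> n" by (simp add: initial_def)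
    with h have "\<exists>k. exec (\<lambda>_. []) (compile P) ?s k (sem (\<lambda>_. []) P ?s)"
      unfolding bounds_def by blast
    moreover have "sem (\<lambda>_. []) P ?s 0 = replicate (g n) True"
      unfolding P_def sem.simps(5) using p(2)[of ?s]
      by (simp add: sem_move sem_clear initial_def del: sem.simps)
    ultimately show ?thesis by blast
  qed
  then show ?thesis unfolding computable_def by blast
qed

section \<open>Searching for a cover\<close>

primrec val :: "bool list \<Rightarrow> nat" where
  "val [] = 0"
| "val (b # bs) = of_bool b + 2 * val bs"

lemma val_less: "val u < 2 ^ length u"
  by (induction u) auto

lemma ex_val: "a < 2 ^ n \<Longrightarrow> \<exists>u\<in>strings n. val u = a"
proof (induction n arbitrary: a)
  case 0
  then show ?case by (simp add: strings_def)
next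
  case (Suc n)
  then have "a div 2 < 2 ^ n" by simp
  from Suc.IH[OF this] obtain u where "length u = n" "val u = a div 2" by (auto simp: strings_def)
  then have "odd a # u \<in> strings (Suc n)" "val (odd a # u) = a"
    by (simp_all add: strings_def)
  then show ?case by blast
qed

text \<open>Horner's rule takes the top of a stack as the most significant bit, whereas
  \<open>val\<close> takes the head as the least significant one. Hence the machine reverses its
  input, and data \<open>d\<close> name the row \<open>val (rev d)\<close>.\<close>

lemma val_rev: "val (rev u) = foldl (\<lambda>a b. 2 * a + of_bool b) 0 u"
  by (induction u rule: rev_induct) simp_all

definition table_bit :: "bool list \<Rightarrow> nat \<Rightarrow> bool" where
  "table_bit T i \<longleftrightarrow> i < length T \<and> T ! i"

text \<open>
  A number \<open>g\<close> encodes a family of partial predicates on strings of length \<open>m\<close>: bit \<open>2k\<close> says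
  whether entry \<open>k\<close> is defined, bit \<open>2k + 1\<close> gives its value, where \<open>k = y + 2\<^sup>m w\<close> for the
  string with value \<open>y\<close> in row \<open>w\<close>.
\<close>

definition defd :: "nat \<Rightarrow> nat \<Rightarrow> nat \<Rightarrow> nat \<Rightarrow> bool" where
  "defd m g w y \<longleftrightarrow> odd (g div 2 ^ (2 * (y + 2 ^ m * w)))"

definition entry :: "nat \<Rightarrow> nat \<Rightarrow> nat \<Rightarrow> nat \<Rightarrow> bool" where
  "entry m g w y \<longleftrightarrow> odd (g div 2 ^ (2 * (y + 2 ^ m * w) + 1))"

text \<open>The arithmetical form of a cover with \<open>2 ^ l\<close> rows for the function
  tabulated by \<open>Or m\<close>: strings are replaced by their values, so that every quantifier
  is bounded.\<close>

definition good :: "(nat \<Rightarrow> bool list) \<Rightarrow> nat \<Rightarrow> nat \<Rightarrow> nat \<Rightarrow> bool" where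
  "good Or m l g \<longleftrightarrow> (\<forall>x<2 ^ m. \<forall>y<2 ^ m. \<exists>w<2 ^ l.
     (defd m g w y \<and> (entry m g w y \<longleftrightarrow> table_bit (Or m) (y + 2 ^ m * x))) \<and>
     (\<forall>y'<2 ^ m. defd m g w y' \<longrightarrow> (entry m g w y' \<longleftrightarrow> table_bit (Or m) (y' + 2 ^ m * x))))"

text \<open>A canonical choice, made identically by all programs with the same number of data bits,
  so that these bits only have to name a row.\<close>

definition least_good :: "(nat \<Rightarrow> bool list) \<Rightarrow> nat \<Rightarrow> nat \<Rightarrow> nat \<Rightarrow> bool" where
  "least_good Or m l g \<longleftrightarrow> good Or m l g \<and> (\<forall>g'<g. \<not> good Or m l g')"

text \<open>The values 0, 1, 2 stand for undefined, false and true. A table has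
  \<open>2 ^ (m + l)\<close> entries of two bits each, which gives the search bound; if no good
  table exists below it, the value is 0.\<close>

definition verdict :: "(nat \<Rightarrow> bool list) \<Rightarrow> nat \<Rightarrow> nat \<Rightarrow> nat \<Rightarrow> nat \<Rightarrow> nat" where
  "verdict Or m y l w =
     of_bool (\<exists>g<2 ^ (2 * 2 ^ (m + l)). least_good Or m l g \<and> defd m g w y) +
     of_bool (\<exists>g<2 ^ (2 * 2 ^ (m + l)). least_good Or m l g \<and> (defd m g w y \<and> entry m g w y))"

lemma cmp_defd:
  assumes "cmp Or V M" "cmp Or V G" "cmp Or V W" "cmp Or V Y"
  shows "cmp Or V (\<lambda>e. of_bool (defd (M e) (G e) (W e) (Y e)))"
  unfolding defd_def by (intro cmp_odd_div cmp_times cmp_plus cmp_power2 cmp_const assms)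

lemma cmp_entry:
  assumes "cmp Or V M" "cmp Or V G" "cmp Or V W" "cmp Or V Y"
  shows "cmp Or V (\<lambda>e. of_bool (entry (M e) (G e) (W e) (Y e)))"
  unfolding entry_def by (intro cmp_odd_div cmp_times cmp_plus cmp_power2 cmp_const assms)

lemma cmp_table_bit:
  assumes "cmp Or V M" "cmp Or V X" "cmp Or V Y"
  shows "cmp Or V (\<lambda>e. of_bool (table_bit (Or (M e)) (Y e + 2 ^ M e * X e)))"
  unfolding table_bit_def by (intro cmp_oracle cmp_times cmp_plus cmp_power2 assms)

lemma cmp_good:
  assumes M: "cmp Or V M" and L: "cmp Or V L" and G: "cmp Or V G"
  shows "cmp Or V (\<lambda>e. of_bool (good Or (M e) (L e) (G e)))"
proof -
  \<comment> \<open>\<open>v0\<close> to \<open>v3\<close> are the quantified variables from the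
    innermost outwards; the digit in \<open>M1\<close>, \<open>G3\<close>, \<open>L2\<close> and so
    on is the number of quantifiers passed.\<close>
  note v0 = cmp_ext_snd and v1 = cmp_weaken[OF cmp_ext_snd]
    and v2 = cmp_weaken[OF cmp_weaken[OF cmp_ext_snd]]
    and v3 = cmp_weaken[OF cmp_weaken[OF cmp_weaken[OF cmp_ext_snd]]]
  note M1 = cmp_weaken[OF M]
  note M2 = cmp_weaken[OF M1]
  note M3 = cmp_weaken[OF M2]
  note M4 = cmp_weaken[OF M3]
  note G3 = cmp_weaken[OF cmp_weaken[OF cmp_weaken[OF G]]]
  note G4 = cmp_weaken[OF G3]
  note L2 = cmp_weaken[OF cmp_weaken[OF L]]
  show ?thesis unfolding good_def
    by (intro cmp_ball cmp_bex cmp_conj cmp_imp cmp_iff cmp_defd cmp_entry cmp_table_bit cmp_power2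
        M M1 M2 M3 M4 G3 G4 L2 v0 v1 v2 v3)
qed

lemma cmp_least_good:
  assumes M: "cmp Or V M" and L: "cmp Or V L" and G: "cmp Or V G"
  shows "cmp Or V (\<lambda>e. of_bool (least_good Or (M e) (L e) (G e)))"
  unfolding least_good_def
  by (intro cmp_conj cmp_ball cmp_not cmp_good assms cmp_weaken[OF M] cmp_weaken[OF L] cmp_ext_snd)

lemma cmp_verdict:
  assumes M: "cmp Or V M" and Y: "cmp Or V Y" and L: "cmp Or V L" and W: "cmp Or V W"
  shows "cmp Or V (\<lambda>e. verdict Or (M e) (Y e) (L e) (W e))"
  unfolding verdict_def
  by (intro cmp_plus cmp_bex cmp_conj cmp_least_good cmp_defd cmp_entry cmp_power2 cmp_times
      cmp_const assms assms[THEN cmp_weaken] cmp_ext_snd)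

section \<open>From covers to good tables below the search bound\<close>

lemma ex_bit_pattern: "\<exists>g<(2 :: nat) ^ L. \<forall>j<L. odd (g div 2 ^ j) \<longleftrightarrow> Q j" for L :: nat and Q
proof (induction L arbitrary: Q)
  case 0
  then show ?case by auto
next
  case (Suc L)
  obtain g :: nat where g: "g < 2 ^ L" "\<And>j. j < L \<Longrightarrow> odd (g div 2 ^ j) \<longleftrightarrow> Q (Suc j)"
    using Suc.IH[of "\<lambda>j. Q (Suc j)"] by auto
  let ?g = "of_bool (Q 0) + 2 * g"
  have "?g < 2 ^ Suc L" using g(1) by auto
  moreover have "odd (?g div 2 ^ j) \<longleftrightarrow> Q j" if "j < Suc L" for j
  proof (cases j)
    case 0
    then show ?thesis by simp
  next
    case (Suc i)
    then have "?g div 2 ^ j = ?g div 2 div 2 ^ i" by (simp only: power_Suc div_mult2_eq)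
    also have "?g div 2 = g" by simp
    finally show ?thesis using g(2)[of i] that Suc by simp
  qed
  ultimately show ?case by blast
qed

text \<open>
  The rows of \<open>G\<close> abstract from both sides of the theorem: a row is the set of inputs of Bob
  compatible with a conversation, labelled by its outcome, or the partial predicate decided by a
  program.
\<close>

definition cover :: "nat \<Rightarrow> (bool list \<Rightarrow> bool list \<Rightarrow> bool) \<Rightarrow> nat \<Rightarrow> bool" where
  "cover n h W \<longleftrightarrow> (\<exists>G :: nat \<Rightarrow> bool list \<Rightarrow> bool option.
     \<forall>x\<in>strings n. \<forall>y\<in>strings n. \<exists>i<W. G i y = Some (h x y) \<and>
       (\<forall>y'\<in>strings n. \<forall>z. G i y' = Some z \<longrightarrow> z = h x y'))"

lemma all_less_power2_iff: "(\<forall>a<2 ^ n. P a) \<longleftrightarrow> (\<forall>u\<in>strings n. P (val u))"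
  using ex_val val_less by (fastforce simp: strings_def)

lemma cover_imp_good:
  assumes "cover n h (2 ^ l)"
    and "\<And>x y. x \<in> strings n \<Longrightarrow> y \<in> strings n \<Longrightarrow> table_bit (Or n) (val y + 2 ^ n * val x) = h x y"
  shows "\<exists>g<2 ^ (2 * 2 ^ (n + l)). good Or n l g"
proof -
  from assms(1) obtain G :: "nat \<Rightarrow> bool list \<Rightarrow> bool option"
    where G: "\<And>x y. x \<in> strings n \<Longrightarrow> y \<in> strings n \<Longrightarrow> \<exists>i<2 ^ l. G i y = Some (h x y) \<and>
      (\<forall>y'\<in>strings n. \<forall>z. G i y' = Some z \<longrightarrow> z = h x y')"
    unfolding cover_def by metis
  define str where "str a = (SOME u. u \<in> strings n \<and> val u = a)" for a
  have inj: "u = v" if "length u = length v" "val u = val v" for u v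
    using that
  proof (induction u v rule: list_induct2)
    case (Cons a u b v)
    then show ?case by (cases a; cases b) (auto dest: arg_cong[of _ _ even])
  qed simp
  have str: "str (val u) = u" if "u \<in> strings n" for u
    unfolding str_def by (rule some_equality) (use that inj in \<open>auto simp: strings_def\<close>)
  define Q where "Q j \<longleftrightarrow> (let k = j div 2; e = G (k div 2 ^ n) (str (k mod 2 ^ n)) in
    if even j then e \<noteq> None else e = Some True)" for j
  from ex_bit_pattern[of "2 * 2 ^ (n + l)" Q] obtain g :: nat
    where g: "g < 2 ^ (2 * 2 ^ (n + l))"
    "\<And>j. j < 2 * 2 ^ (n + l) \<Longrightarrow> odd (g div 2 ^ j) \<longleftrightarrow> Q j" by blast
  have bits: "defd n g i (val y) \<longleftrightarrow> G i y \<noteq> None" "entry n g i (val y) \<longleftrightarrow> G i y = Some True"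
    if "i < 2 ^ l" "y \<in> strings n" for i y
  proof -
    have y: "val y < 2 ^ n" using that(2) val_less[of y] by (simp add: strings_def)
    define k where "k = val y + 2 ^ n * i"
    have k: "k div 2 ^ n = i" "k mod 2 ^ n = val y" using y by (simp_all add: k_def)
    have "k < 2 ^ n * (1 + i)" using y by (simp add: k_def)
    also have "\<dots> \<le> 2 ^ n * 2 ^ l" using that(1) by (intro mult_left_mono) auto
    finally have "k < 2 ^ (n + l)" by (simp add: power_add)
    then have "2 * k < 2 * 2 ^ (n + l)" "2 * k + 1 < 2 * 2 ^ (n + l)" by linarith+
    from this[THEN g(2)] show "defd n g i (val y) \<longleftrightarrow> G i y \<noteq> None"
      "entry n g i (val y) \<longleftrightarrow> G i y = Some True"
      unfolding defd_def entry_def k_def[symmetric] by (simp_all add: Q_def k str[OF that(2)])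
  qed
  have "good Or n l g"
    unfolding good_def all_less_power2_iff
  proof (intro ballI)
    fix x y assume xy: "x \<in> strings n" "y \<in> strings n"
    from G[OF xy] obtain i where i: "i < 2 ^ l" "G i y = Some (h x y)"
      "\<And>y' z. y' \<in> strings n \<Longrightarrow> G i y' = Some z \<Longrightarrow> z = h x y'" by blast
    have row: "entry n g i (val y') \<longleftrightarrow> h x y'" if "y' \<in> strings n" "defd n g i (val y')" for y'
    proof -
      from that bits(1)[OF i(1) that(1)] obtain z where "G i y' = Some z" by blast
      with bits(2)[OF i(1) that(1)] i(3)[OF that(1)] show ?thesis by simp
    qed
    have "defd n g i (val y)" using bits(1)[OF i(1) xy(2)] i(2) by simp
    with row xy i(1) show "\<exists>w<2 ^ l. (defd n g w (val y) \<and>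
        (entry n g w (val y) \<longleftrightarrow> table_bit (Or n) (val y + 2 ^ n * val x))) \<and>
      (\<forall>y'\<in>strings n. defd n g w (val y') \<longrightarrow>
        (entry n g w (val y') \<longleftrightarrow> table_bit (Or n) (val y' + 2 ^ n * val x)))"
      by (intro exI[of _ i] conjI ballI impI) (simp_all add: assms(2))
  qed
  with g(1) show ?thesis by blast
qed

section \<open>Positions in the truth table\<close>

lemma nth_concat_map:
  assumes "i < length xs" "j < length ys"
  shows "concat (map (\<lambda>x. map (h x) ys) xs) ! (j + length ys * i) = h (xs ! i) (ys ! j)"
  using assms(1)
proof (induction xs arbitrary: i)
  case (Cons x xs)
  then show ?case using assms(2) by (cases i) (auto simp: nth_append)
qed simp

lemma length_n_lists_bool: "length (List.n_lists n [False, True]) = 2 ^ n"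
  by (simp add: length_n_lists numeral_2_eq_2)

text \<open>\<open>List.n_lists\<close> varies the head fastest, which is the reason for letting
  \<open>val\<close> treat the head as the least significant bit.\<close>

lemma nth_n_lists_val: "List.n_lists (length u) [False, True] ! val u = u"
proof (induction u)
  case (Cons b u)
  have "val u < length (List.n_lists (length u) [False, True])"
    using val_less[of u] by (simp only: length_n_lists_bool)
  from nth_concat_map[OF this, of "of_bool b" "[False, True]" "\<lambda>x a. a # x"] Cons show ?case
    by (cases b) (simp_all add: mult_2)
qed simp

lemma table_bit_truth_table:
  assumes "x \<in> strings n" "y \<in> strings n"
  shows "table_bit (truth_table f n) (val y + 2 ^ n * val x) = f n x y"
proof -
  have xy: "val x < 2 ^ n" "val y < 2 ^ n"
    using assms val_less[of x] val_less[of y] by (simp_all add: strings_def)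
  have "val y + 2 ^ n * val x < 2 ^ n * (1 + val x)" using xy by simp
  also have "\<dots> \<le> 2 ^ n * 2 ^ n" using xy by (intro mult_left_mono) auto
  finally have "val y + 2 ^ n * val x < 2 ^ n * 2 ^ n" .
  moreover have "length (truth_table f n) = 2 ^ n * 2 ^ n"
    by (simp add: truth_table_def length_concat comp_def sum_list_triv length_n_lists_bool)
  moreover have "truth_table f n ! (val y + 2 ^ n * val x) = f n x y"
    using nth_concat_map[of "val x" "List.n_lists n [False, True]" "val y"
      "List.n_lists n [False, True]" "f n"] xy assms nth_n_lists_val[of x] nth_n_lists_val[of y]
    by (simp add: truth_table_def length_n_lists_bool strings_def)
  ultimately show ?thesis by (simp add: table_bit_def)
qed

lemma bounded_oracle_truth_table: "bounded_oracle (truth_table f)"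
proof -
  have "2 ^ n * 2 ^ n = (4 :: nat) ^ n" for n by (simp flip: power_mult_distrib)
  then show ?thesis
    by (simp add: bounded_oracle_def truth_table_def length_concat comp_def sum_list_triv
        length_n_lists_bool)
qed

section \<open>The machine\<close>

lemma sem_For_Cons:
  assumes "s r = b # bs" "r \<notin> writes p"
  shows "sem Or (For r p) s = sem Or (For r p) ((sem Or p s)(r := bs))"
  using assms by (simp add: sem_unwritten funpow_Suc_right del: funpow.simps)

lemma sem_For_Nil: "s r = [] \<Longrightarrow> sem Or (For r p) s = s"
  by simp

text \<open>Besides reversing, this records the input length in register 4, as the argument
  \<open>m\<close> of the verdict, and in register 7, as the allowance of data bits. Register 0 is
  left empty for the output.\<close>

definition reverse_input :: prog where
  "reverse_input = For 0 (PCond (Top 0) (PPush 3 True) (PPush 3 False) ;;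
     (PPush 4 True ;; PPush 7 True))"

lemma sem_reverse_input:
  "sem Or reverse_input s = s(0 := [], 3 := rev (s 0) @ s 3,
     4 := replicate (length (s 0)) True @ s 4, 7 := replicate (length (s 0)) True @ s 7)"
proof (induction "s 0" arbitrary: s)
  case Nil
  then show ?case by (simp add: reverse_input_def sem_For_Nil fun_eq_iff)
next
  case (Cons b u)
  let ?s = "s(0 := u, 3 := b # s 3, 4 := True # s 4, 7 := True # s 7)"
  have "sem Or reverse_input s = sem Or reverse_input ?s"
    unfolding reverse_input_def
    by (subst sem_For_Cons[of s 0 b u])
      (simp_all add: Cons.hyps(2)[symmetric] fun_upd_twist del: sem.simps(7))
  also have "\<dots> = s(0 := [], 3 := rev (s 0) @ s 3,
     4 := replicate (length (s 0)) True @ s 4, 7 := replicate (length (s 0)) True @ s 7)"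
    using Cons.hyps(1)[of ?s] Cons.hyps(2)[symmetric]
    by (simp add: fun_eq_iff replicate_app_Cons_same)
  finally show ?case .
qed

definition double :: "nat \<Rightarrow> prog" where
  "double r = clear 2 ;; clear 6 ;; move2 r 2 6 ;; move 2 r ;; move 6 r"

lemma sem_double:
  assumes "r \<noteq> 2" "r \<noteq> 6"
  shows "sem Or (double r) s = s(2 := [], 6 := [], r := replicate (2 * length (s r)) True)"
proof -
  have "replicate n True @ replicate n True = replicate (2 * n) True" for n
    by (simp flip: replicate_add)
  with assms show ?thesis
    unfolding double_def sem.simps(5)
    by (auto simp: sem_clear sem_move sem_move2 fun_eq_iff simp del: sem.simps)
qed

lemma double_simps: "writes (double r) = {2, 6, r}" "tame (double r) \<longleftrightarrow> r \<noteq> 1 \<and> r \<noteq> 2 \<and> r \<noteq> 6"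
  by (auto simp: double_def)

definition horner_input :: prog where
  "horner_input = For 3 (double 5 ;; PCond (Top 3) (PPush 5 True) PSkip)"

lemma sem_horner_input:
  "length (sem Or horner_input s 5) = foldl (\<lambda>a b. 2 * a + of_bool b) (length (s 5)) (s 3)"
proof (induction "s 3" arbitrary: s)
  case Nil
  then show ?case by (simp add: horner_input_def)
next
  case (Cons b u)
  let ?s = "s(2 := [], 6 := [], 3 := u,
    5 := (if b then [True] else []) @ replicate (2 * length (s 5)) True)"
  have "sem Or horner_input s = sem Or horner_input ?s"
    unfolding horner_input_def
    by (subst sem_For_Cons[of s 3 b u])
      (simp_all add: Cons.hyps(2)[symmetric] sem_double double_simps fun_upd_twist
        del: sem.simps(7))
  then show ?case
    using Cons.hyps(1)[of ?s] Cons.hyps(2)[symmetric] by (cases b) simp_all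
qed

text \<open>Register 1 must not control a loop, so register 7 does: at most as many data bits are
  read as the input has. Register 8 receives their value, the row, and register 9 their number, the
  \<open>l\<close> of the table.\<close>

definition horner_data :: prog where
  "horner_data = For 7 (PCond (Nonempty 1)
     (double 8 ;; (PCond (Top 1) (PPush 8 True) PSkip ;; (PPop 1 ;; PPush 9 True))) PSkip)"

lemma sem_horner_data:
  assumes "length (s 1) \<le> length (s 7)"
  shows "length (sem Or horner_data s 8) = foldl (\<lambda>a b. 2 * a + of_bool b) (length (s 8)) (s 1) \<and>
    length (sem Or horner_data s 9) = length (s 9) + length (s 1)"
  using assms
proof (induction "s 7" arbitrary: s)
  case Nil
  then show ?case by (simp add: horner_data_def)
next
  case (Cons c u)
  note IH = Cons.hyps(1) and c = Cons.hyps(2)[symmetric]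
  note prems = Cons.prems
  show ?case
  proof (cases "s 1")
    case Nil
    have "sem Or horner_data s = sem Or horner_data (s(7 := u))"
      unfolding horner_data_def
      by (subst sem_For_Cons[of s 7 c u])
        (simp_all add: c Nil[unfolded One_nat_def] double_simps del: sem.simps(7))
    then show ?thesis using IH[of "s(7 := u)"] Nil by simp
  next
    case (Cons b w)
    let ?s = "s(2 := [], 6 := [], 1 := w, 7 := u, 9 := True # s 9,
      8 := (if b then [True] else []) @ replicate (2 * length (s 8)) True)"
    have "sem Or horner_data s = sem Or horner_data ?s"
      unfolding horner_data_def
      by (subst sem_For_Cons[of s 7 c u])
        (simp_all add: c Cons[unfolded One_nat_def] sem_double double_simps fun_upd_twist
          del: sem.simps(7))
    then show ?thesis
      using IH[of ?s] Cons prems c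
      by (cases b) simp_all
  qed
qed

definition write_output :: prog where
  "write_output = PCond (Nonempty 10)
     (PPop 10 ;; PCond (Nonempty 10) (PPush 0 True) (PPush 0 False)) PSkip"

lemma sem_write_output:
  assumes "s 0 = []"
  shows "sem Or write_output s 0 = (if length (s 10) = 0 then [] else [length (s 10) \<noteq> 1])"
  using assms by (cases "s 10") (auto simp: write_output_def)

text \<open>The first requirement on outputs covers all data, since a program must answer validly
  also on inputs too short for its data; the second fixes the answer where all data bits are
  read.\<close>

definition run_verdict :: "(nat \<Rightarrow> bool list) \<Rightarrow> prog \<Rightarrow> bool" where
  "run_verdict Or p \<longleftrightarrow> tame p \<and> (\<forall>u d. sem Or p (initial u d) 0 \<in> {[], [False], [True]} \<and>
     (length d \<le> length u \<longrightarrow>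
       (let v = verdict Or (length u) (val u) (length d) (val (rev d))
        in sem Or p (initial u d) 0 = (if v = 0 then [] else [v \<noteq> 1]))))"

lemma ex_run_verdict: "\<exists>p. run_verdict Or p"
proof -
  \<comment> \<open>The environment is the quadruple \<open>(m, y, l, w)\<close>, held by registers
    4, 5, 9, 8.\<close>
  define V :: "(nat \<times> nat \<times> nat \<times> nat \<Rightarrow> nat) list" where
    "V = [\<lambda>e. fst e, \<lambda>e. fst (snd e), \<lambda>e. fst (snd (snd e)), \<lambda>e. snd (snd (snd e))]"
  have "cmp Or V (\<lambda>e. verdict Or (fst e) (fst (snd e)) (fst (snd (snd e))) (snd (snd (snd e))))"
    by (intro cmp_verdict cmp_var) (simp_all add: V_def)
  then obtain q where q: "tame q" "writes q \<subseteq> set [4, 5, 9, 8] \<union> {10..}"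
    "\<And>s e. map (\<lambda>r. length (s r)) [4, 5, 9, 8] = map (\<lambda>v. v e) V \<Longrightarrow> length (sem Or q s 10) =
      verdict Or (fst e) (fst (snd e)) (fst (snd (snd e))) (snd (snd (snd e)))"
    by (rule cmpE[of _ _ _ "[4, 5, 9, 8]" 10]) (simp_all add: V_def, elim disjE, simp_all)
  define p where "p = reverse_input ;; horner_input ;; horner_data ;; q ;; write_output"
  have t: "tame p" using q(1)
    by (simp add: p_def reverse_input_def horner_input_def horner_data_def write_output_def
        double_simps)
  have w: "writes horner_input = {3, 2, 6, 5}" "writes horner_data = {7, 2, 6, 8, 1, 9}"
    by (auto simp: horner_input_def horner_data_def double_simps)
  have "sem Or p (initial u d) 0 \<in> {[], [False], [True]} \<and>
     (length d \<le> length u \<longrightarrow>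
       (let v = verdict Or (length u) (val u) (length d) (val (rev d))
        in sem Or p (initial u d) 0 = (if v = 0 then [] else [v \<noteq> 1])))" for u d
  proof -
    define s1 where "s1 = sem Or reverse_input (initial u d)"
    define s2 where "s2 = sem Or horner_input s1"
    define s3 where "s3 = sem Or horner_data s2"
    define s4 where "s4 = sem Or q s3"
    have s1: "s1 = (\<lambda>_. [])(0 := [], 1 := d, 3 := rev u, 4 := replicate (length u) True,
        7 := replicate (length u) True)"
      by (auto simp: s1_def sem_reverse_input initial_def)
    have s2: "s2 r = s1 r" if "r \<notin> {3, 2, 6, 5}" for r
      using that by (simp add: s2_def sem_unwritten w)
    have s3: "s3 r = s2 r" if "r \<notin> {7, 2, 6, 8, 1, 9}" for r
      using that by (simp add: s3_def sem_unwritten w)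
    have "0 \<notin> writes q" using q(2) by auto
    then have "s4 0 = []" by (simp add: s4_def sem_unwritten s3 s2 s1)
    moreover have "sem Or p (initial u d) = sem Or write_output s4"
      by (simp add: p_def s1_def s2_def s3_def s4_def)
    ultimately have out: "sem Or p (initial u d) 0 =
        (if length (s4 10) = 0 then [] else [length (s4 10) \<noteq> 1])"
      by (simp only: sem_write_output)
    have "length (s4 10) = verdict Or (length u) (val u) (length d) (val (rev d))"
      if "length d \<le> length u"
    proof -
      have "length (s3 4) = length u" by (simp add: s3 s2 s1)
      moreover have "length (s3 5) = val u"
        using sem_horner_input[of Or s1] val_rev[of "rev u"]
        by (simp add: s3 flip: s2_def) (simp add: s1)
      moreover have "length (s2 1) \<le> length (s2 7)" using that by (simp add: s2 s1)
      from sem_horner_data[OF this, of Or]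
      have "length (s3 8) = val (rev d)" "length (s3 9) = length d"
        by (simp_all add: val_rev flip: s3_def) (simp_all add: s2 s1)
      ultimately show ?thesis
        using q(3)[of s3 "(length u, val u, length d, val (rev d))"] by (simp add: V_def s4_def)
    qed
    with out show ?thesis by (auto simp: Let_def)
  qed
  with t have "run_verdict Or p" by (simp add: run_verdict_def)
  then show ?thesis ..
qed

text \<open>The data bits name a row consistent with \<open>f n x\<close> and defined at
  \<open>y\<close>. Because of \<open>l \<le> n\<close>, the machine reads all of them on inputs of
  length \<open>n\<close>; \<open>c\<close> is the length of the machine code.\<close>

lemma ic_le_cover:
  "\<exists>t c. computable t \<and> (\<forall>n l x y. cover n (f n) (2 ^ l) \<longrightarrow> l \<le> n \<longrightarrow> x \<in> strings n \<longrightarrow>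
     y \<in> strings n \<longrightarrow> ic f t n y (Y1 f n x) \<le> enat (l + c))"
proof -
  let ?Or = "truth_table f"
  obtain p where p: "tame p"
    "\<And>u d. sem ?Or p (initial u d) 0 \<in> {[], [False], [True]}"
    "\<And>u d. length d \<le> length u \<Longrightarrow> sem ?Or p (initial u d) 0 =
      (if verdict ?Or (length u) (val u) (length d) (val (rev d)) = 0 then []
       else [verdict ?Or (length u) (val u) (length d) (val (rev d)) \<noteq> 1])"
    using ex_run_verdict[of ?Or] by (auto simp: run_verdict_def Let_def)
  from gauge_bounds[OF bounded_oracle_truth_table p(1)] obtain t where
    t: "gauge t" "bounds ?Or p t" by blast
  have run: "\<exists>k \<le> t (length u). universal ?Or (encode (compile p) @ d) u k
      (sem ?Or p (initial u d) 0)" for u d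
  proof -
    obtain k where k: "exec ?Or (compile p) (initial u d) k (sem ?Or p (initial u d))"
      "\<And>r. r \<noteq> 1 \<Longrightarrow> length (sem ?Or p (initial u d) r) + (0 + k) \<le> t (length u)"
      by (rule boundsE[OF t(2), of "initial u d" 0 "length u"]) (auto simp: initial_def)
    from k(2)[of 0] have "k \<le> t (length u)" by simp
    with k(1) show ?thesis unfolding universal_def by blast
  qed
  have returns: "returns f (encode (compile p) @ d) u v \<longleftrightarrow> v = sem ?Or p (initial u d) 0" for d u v
    using run[of u d] universal_deterministic unfolding returns_def by metis
  have "ic f t n y (Y1 f n x) \<le> enat (l + length (encode (compile p)))"
    if cov: "cover n (f n) (2 ^ l)" and l: "l \<le> n" and x: "x \<in> strings n" and y: "y \<in> strings n"
    for n l x y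
  proof -
    let ?B = "2 ^ (2 * 2 ^ (n + l)) :: nat"
    define g where "g = (LEAST g. good ?Or n l g)"
    from cover_imp_good[where Or = ?Or, OF cov table_bit_truth_table[where f = f]]
    obtain g0 where g0: "g0 < ?B" "good ?Or n l g0" by blast
    from g0(2) have good: "good ?Or n l g" unfolding g_def by (rule LeastI)
    have "g \<le> g0" using g0(2) unfolding g_def by (rule Least_le)
    with g0(1) have "g < ?B" by simp
    \<comment> \<open>At most one number is least, so both existential statements in
      \<open>verdict\<close> speak about \<open>g\<close>.\<close>
    have least: "least_good ?Or n l g' \<longleftrightarrow> g' = g" for g'
      unfolding least_good_def using good not_less_Least[of _ "good ?Or n l", folded g_def]
      by (metis linorder_neqE_nat)
    have verdict: "verdict ?Or n a l w =
        of_bool (defd n g w a) + of_bool (defd n g w a \<and> entry n g w a)" for a w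
      unfolding verdict_def least using \<open>g < ?B\<close> by simp
    have vx: "val x < 2 ^ n" "val y < 2 ^ n"
      using x y val_less[of x] val_less[of y] by (simp_all add: strings_def)
    with good obtain w where w: "w < 2 ^ l" "defd n g w (val y)"
      "\<And>y'. y' < 2 ^ n \<Longrightarrow> defd n g w y' \<Longrightarrow>
        (entry n g w y' \<longleftrightarrow> table_bit (?Or n) (y' + 2 ^ n * val x))"
      unfolding good_def by blast
    from ex_val[OF w(1)] obtain d' where d': "length d' = l" "val d' = w"
      by (auto simp: strings_def)
    \<comment> \<open>The machine does not reverse its data, so the name of the row is stored
      backwards.\<close>
    define d where "d = rev d'"
    have out: "sem ?Or p (initial u d) 0 =
        (if defd n g w (val u) then [f n x u] else [])" if "u \<in> strings n" for u
    proof -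
      have "val u < 2 ^ n" "length u = n" using that val_less[of u] by (simp_all add: strings_def)
      moreover have "defd n g w (val u) \<Longrightarrow> entry n g w (val u) \<longleftrightarrow> f n x u"
        using w(3) calculation table_bit_truth_table[OF x that] by metis
      ultimately show ?thesis
        using p(3)[of d u] l d' by (auto simp: d_def verdict)
    qed
    have "\<exists>k v. universal ?Or (encode (compile p) @ d) u k v \<and> k \<le> t (length u)" for u
      using run[of u d] by blast
    then have "ic_program f t n y (Y1 f n x) (encode (compile p) @ d)"
      unfolding ic_program_def returns consistent_def
      using p(2)[of _ d] out w(2) y by (auto simp: Y1_def split: if_splits)
    then have "ic f t n y (Y1 f n x) \<le> enat (length (encode (compile p) @ d))"
      unfolding ic_def by (intro INF_lower) simp
    then show ?thesis by (simp add: d_def d' add.commute)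
  qed
  with computable_gauge[OF t(1)] show ?thesis by blast
qed

section \<open>Covers and protocols\<close>

lemma finite_strings: "finite (strings n)"
  using finite_lists_length_eq[of "UNIV :: bool set" n] by (simp add: strings_def)

lemma strings_nonempty: "strings n \<noteq> {}"
  by (auto simp: strings_def intro: exI[of _ "replicate n True"])

lemma coverI:
  fixes G :: "'i \<Rightarrow> bool list \<Rightarrow> bool option"
  assumes "finite I" "card I \<le> W"
    and "\<And>x y. x \<in> strings n \<Longrightarrow> y \<in> strings n \<Longrightarrow> \<exists>i\<in>I. G i y = Some (h x y) \<and>
       (\<forall>y'\<in>strings n. \<forall>z. G i y' = Some z \<longrightarrow> z = h x y')"
  shows "cover n h W"
proof -
  from assms(1) obtain b where b: "bij_betw b {0..<card I} I"
    using ex_bij_betw_nat_finite by blast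
  show ?thesis unfolding cover_def
  proof (intro exI[of _ "\<lambda>i. G (b i)"] ballI)
    fix x y assume "x \<in> strings n" "y \<in> strings n"
    from assms(3)[OF this] obtain i where i: "i \<in> I" "G i y = Some (h x y)"
      "\<forall>y'\<in>strings n. \<forall>z. G i y' = Some z \<longrightarrow> z = h x y'" by blast
    from i(1) b obtain j where "j < card I" "b j = i"
      unfolding bij_betw_def by force
    with i assms(2) show "\<exists>i<W. G (b i) y = Some (h x y) \<and>
        (\<forall>y'\<in>strings n. \<forall>z. G (b i) y' = Some z \<longrightarrow> z = h x y')"
      by (intro exI[of _ j]) auto
  qed
qed

text \<open>All lengths up to \<open>k\<close> are counted together, which costs a factor 2 when
  conversations or programs become rows.\<close>

lemma card_short_strings: "finite {u :: bool list. length u \<le> k}"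
    "card {u :: bool list. length u \<le> k} \<le> 2 ^ (k + 1)"
proof -
  have fin: "finite {u :: bool list. length u \<le> k}" for k
    using finite_lists_length_le[of "UNIV :: bool set" k] by simp
  then show "finite {u :: bool list. length u \<le> k}" .
  have "card {u :: bool list. length u \<le> k} < 2 ^ (k + 1)"
  proof (induction k)
    case (Suc k)
    have "{u :: bool list. length u \<le> Suc k} = {u. length u \<le> k} \<union> strings (Suc k)"
      by (auto simp: strings_def)
    then have "card {u :: bool list. length u \<le> Suc k} \<le> card {u :: bool list. length u \<le> k} +
        card (strings (Suc k))" by (simp add: card_Un_le)
    also have "card (strings (Suc k)) = 2 ^ Suc k"
      using card_lists_length_eq[of "UNIV :: bool set" "Suc k"] by (simp add: strings_def)
    finally show ?case using Suc by simp
  qed simp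
  then show "card {u :: bool list. length u \<le> k} \<le> 2 ^ (k + 1)" by simp
qed

text \<open>One total row for each \<open>x\<close>. This bounds the logarithm of the least cover by
  \<open>n\<close>, as required for reading the data, and yields some protocol for every
  function.\<close>

lemma cover_trivial: "cover n h (2 ^ n)"
proof (rule coverI[of "strings n" _ _ "\<lambda>x y. Some (h x y)"])
  show "card (strings n) \<le> 2 ^ n"
    using card_lists_length_eq[of "UNIV :: bool set" n] by (simp add: strings_def)
qed (auto simp: finite_strings)

section \<open>From protocols to covers\<close>

text \<open>The classical rectangle property: each bit depends on the earlier bits and on the
  speaker's own input and part of the guess, so a player's input and guess can be exchanged
  together.\<close>

lemma conversation_rectangle:
  assumes "conversation P w x y = c" "conversation P w' x' y' = c"
  shows "conversation P (fst w, snd w') x y' = c"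
  using assms
proof (induction P arbitrary: c)
  case (Alice a P Q)
  then show ?case by (cases "a (fst w) x"; cases "a (fst w') x'") auto
next
  case (Bob b P Q)
  then show ?case by (cases "b (snd w) y"; cases "b (snd w') y'") auto
qed simp

text \<open>A conversation is the path taken in the tree and so determines the leaf.\<close>

lemma outcome_cong:
  "conversation P w x y = conversation P w' x' y' \<Longrightarrow> outcome P w x y = outcome P w' x' y'"
proof (induction P)
  case (Alice a P Q)
  then show ?case by (cases "a (fst w) x"; cases "a (fst w') x'") auto
next
  case (Bob b P Q)
  then show ?case by (cases "b (snd w) y"; cases "b (snd w') y'") auto
qed simp

lemma instance_cost_attained:
  assumes "outcome P w x y = Some z"
  obtains w' where "outcome P w' x y = Some z" "length (conversation P w' x y) = instance_cost P z x y"
proof -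
  have "\<exists>w'. outcome P w' x y = Some z \<and> instance_cost P z x y = length (conversation P w' x y)"
    unfolding instance_cost_def by (rule LeastI_ex) (use assms in blast)
  with that show thesis by metis
qed

lemma finite_instance_costs:
  "finite {instance_cost P z x y | x y. x \<in> strings n \<and> y \<in> strings n \<and> g x y = z}"
  by (rule finite_subset[of _ "(\<lambda>(x, y). instance_cost P z x y) ` (strings n \<times> strings n)"])
    (auto simp: finite_strings)

lemma instance_cost_le:
  assumes "x \<in> strings n" "y \<in> strings n"
  shows "instance_cost P (g x y) x y \<le> one_sided_cost n g P (g x y)"
  unfolding one_sided_cost_def
  by (rule Max_ge) (use assms in \<open>auto simp: finite_instance_costs\<close>)

lemma one_sided_cost_le:
  assumes "\<And>w x y. length (conversation P w x y) \<le> k" "nondet_protocol n g P"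
  shows "one_sided_cost n g P z \<le> k"
proof -
  have "instance_cost P z x y \<le> k" if "x \<in> strings n" "y \<in> strings n" "g x y = z" for x y
  proof -
    from assms(2) that obtain w where "outcome P w x y = Some z"
      unfolding nondet_protocol_def by blast
    then show ?thesis by (rule instance_cost_attained) (metis assms(1))
  qed
  then show ?thesis
    unfolding one_sided_cost_def by (subst Max_le_iff) (auto simp: finite_instance_costs)
qed

text \<open>Cut and paste shows the consistency of a row with \<open>g x\<close>: any
  \<open>y'\<close> compatible with the conversation can replace \<open>y\<close> opposite
  \<open>x\<close> without changing conversation or outcome, and correctness of the protocol makes
  this outcome \<open>g x y'\<close>.\<close>

lemma protocol_imp_cover:
  assumes "nondet_protocol n g P"
    and "\<And>z. one_sided_cost n g P z \<le> k"
  shows "cover n g (2 ^ (k + 1))"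
proof -
  define G where "G c y = (if \<exists>w x. conversation P w x y = c
    then (SOME r. \<exists>w x. conversation P w x y = c \<and> r = outcome P w x y) else None)" for c y
  have G: "G (conversation P w x y) y = outcome P w x y" for w x y
  proof -
    have "(SOME r. \<exists>w' x'. conversation P w' x' y = conversation P w x y \<and>
        r = outcome P w' x' y) = outcome P w x y"
      by (rule some_equality) (use outcome_cong in blast)+
    moreover have "\<exists>w' x'. conversation P w' x' y = conversation P w x y" by blast
    ultimately show ?thesis by (simp only: G_def if_True)
  qed
  show ?thesis
  proof (rule coverI[OF card_short_strings, where G = G])
    fix x y assume xy: "x \<in> strings n" "y \<in> strings n"
    from assms(1) xy obtain w0 where "outcome P w0 x y = Some (g x y)"
      unfolding nondet_protocol_def by blast
    then obtain w where w: "outcome P w x y = Some (g x y)"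
      "length (conversation P w x y) = instance_cost P (g x y) x y"
      by (rule instance_cost_attained)
    let ?c = "conversation P w x y"
    have "length ?c \<le> k"
      using w(2) instance_cost_le[OF xy, of P g] assms(2)[of "g x y"] by simp
    moreover have "z = g x y'" if y': "y' \<in> strings n" and z: "G ?c y' = Some z" for y' z
    proof -
      from z obtain w' x' where c: "conversation P w' x' y' = ?c"
        unfolding G_def by (metis option.distinct(1))
      \<comment> \<open>Alice's part of the guess belongs to \<open>x\<close>, Bob's part to
        \<open>y'\<close>.\<close>
      let ?w = "(fst w, snd w')"
      from conversation_rectangle[OF refl c] have "conversation P ?w x y' = ?c" .
      with G[of ?w x y'] z have "outcome P ?w x y' = Some z" by simp
      with assms(1) xy(1) y' show ?thesis unfolding nondet_protocol_def by metis
    qed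
    ultimately show "\<exists>i\<in>{u. length u \<le> k}. G i y = Some (g x y) \<and>
        (\<forall>y'\<in>strings n. \<forall>z. G i y' = Some z \<longrightarrow> z = g x y')"
      using G w(1) by (intro bexI[of _ ?c]) auto
  qed
qed

section \<open>From covers to protocols, and the value of the complexity\<close>

text \<open>Alice sends \<open>k\<close> bits of her guess, collected in \<open>u\<close>, and one
  bit vouching for consistency; Bob spends at most two on definedness and value, whence
  \<open>k + 3\<close>. A guess shorter than \<open>k\<close> yields unspecified bits, but
  \<open>A\<close> checks whatever has been announced.\<close>

primrec announce :: "(bool list \<Rightarrow> bool list \<Rightarrow> bool) \<Rightarrow> (bool list \<Rightarrow> bool list \<Rightarrow> bool option) \<Rightarrow>
    nat \<Rightarrow> bool list \<Rightarrow> protocol" where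
  "announce A B 0 u = Alice (\<lambda>_ x. A u x) (Output None)
     (Bob (\<lambda>_ y. B u y \<noteq> None) (Output None)
       (Bob (\<lambda>_ y. B u y = Some True) (Output (Some False)) (Output (Some True))))"
| "announce A B (Suc k) u = Alice (\<lambda>wA _. wA ! length u)
     (announce A B k (u @ [False])) (announce A B k (u @ [True]))"

lemma outcome_announce:
  "outcome (announce A B k u) w x y =
    (let v = u @ map ((!) (fst w)) [length u..<length u + k] in if A v x then B v y else None)"
proof (induction k arbitrary: u)
  case 0
  then show ?case by auto
next
  case (Suc k)
  have "[length u..<length u + Suc k] = length u # [Suc (length u)..<Suc (length u) + k]"
    by (simp add: upt_rec)
  then show ?case by (cases "fst w ! length u") (simp_all add: Suc)
qed

lemma length_conversation_announce: "length (conversation (announce A B k u) w x y) \<le> k + 3"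
proof (induction k arbitrary: u)
  case (Suc k)
  show ?case using Suc[of "u @ [False]"] Suc[of "u @ [True]"] by simp
qed simp

lemma cover_imp_protocol:
  assumes "cover n g (2 ^ k)"
  shows "\<exists>P. nondet_protocol n g P \<and> (\<forall>z. one_sided_cost n g P z \<le> k + 3)"
proof -
  from assms obtain G :: "nat \<Rightarrow> bool list \<Rightarrow> bool option"
    where G: "\<And>x y. x \<in> strings n \<Longrightarrow> y \<in> strings n \<Longrightarrow> \<exists>i<2 ^ k. G i y = Some (g x y) \<and>
      (\<forall>y'\<in>strings n. \<forall>z. G i y' = Some z \<longrightarrow> z = g x y')"
    unfolding cover_def by metis
  define A where "A u x \<longleftrightarrow> (\<forall>y\<in>strings n. \<forall>z. G (val u) y = Some z \<longrightarrow> z = g x y)" for u x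
  define P where "P = announce A (\<lambda>u. G (val u)) k []"
  have P: "nondet_protocol n g P"
    unfolding nondet_protocol_def
  proof (intro ballI allI conjI impI)
    fix x y z assume xy: "x \<in> strings n" "y \<in> strings n" and z: "g x y = z"
    from G[OF xy] obtain i where i: "i < 2 ^ k" "G i y = Some (g x y)"
      "\<And>y' z. y' \<in> strings n \<Longrightarrow> G i y' = Some z \<Longrightarrow> z = g x y'" by blast
    from ex_val[OF i(1)] obtain u where u: "length u = k" "val u = i" by (auto simp: strings_def)
    have "A u x" using i(3) u by (simp add: A_def)
    moreover have "map ((!) u) [0..<k] = u" using u(1) map_nth by blast
    ultimately have "outcome P (u, []) x y = Some z"
      using i(2) u z by (simp add: P_def outcome_announce)
    then show "\<exists>w. outcome P w x y = Some z" ..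
  next
    fix x y z w assume xy: "x \<in> strings n" "y \<in> strings n" and z: "g x y \<noteq> z"
    then show "outcome P w x y \<noteq> Some z"
      by (auto simp: P_def outcome_announce A_def Let_def)
  qed
  have "length (conversation P w x y) \<le> k + 3" for w x y
    unfolding P_def by (rule length_conversation_announce)
  with P one_sided_cost_le show ?thesis by blast
qed

text \<open>\<open>LEAST\<close> on the reals is meaningful only where a minimum exists. Costs are
  logarithms of positive natural numbers, among which a least one is attained as soon as some
  protocol exists.\<close>

lemma nondet_complexity_attained:
  obtains P where "nondet_protocol n g P" "nondet_complexity n g = protocol_cost n g P"
    "\<And>Q. nondet_protocol n g Q \<Longrightarrow> nondet_complexity n g \<le> protocol_cost n g Q"
proof -
  define M :: "protocol \<Rightarrow> nat"
    where "M P = 2 ^ one_sided_cost n g P False + 2 ^ one_sided_cost n g P True" for P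
  have cost: "protocol_cost n g P = log 2 (M P)" for P
    by (simp add: protocol_cost_def M_def)
  have M: "0 < M P" for P by (simp add: M_def)
  obtain P where P: "nondet_protocol n g P" "\<And>Q. nondet_protocol n g Q \<Longrightarrow> M P \<le> M Q"
    using ex_has_least_nat[of "nondet_protocol n g" _ M] cover_imp_protocol[OF cover_trivial]
    by metis
  have min: "protocol_cost n g P \<le> protocol_cost n g Q" if "nondet_protocol n g Q" for Q
    using P(2)[OF that] M[of P] M[of Q] by (simp add: cost)
  have "nondet_complexity n g = protocol_cost n g P"
    unfolding nondet_complexity_def by (rule Least_equality) (use P(1) min in auto)
  with P min that show thesis by metis
qed

text \<open>Of the 4 extra bits, 3 come from the verification in the protocol and 1 from adding the
  two powers.\<close>

lemma nondet_complexity_le: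
  assumes "cover n g (2 ^ k)"
  shows "nondet_complexity n g \<le> real k + 4"
proof -
  from cover_imp_protocol[OF assms] obtain P where P: "nondet_protocol n g P"
    "\<And>z. one_sided_cost n g P z \<le> k + 3" by blast
  have "(2 :: real) ^ one_sided_cost n g P z \<le> 2 ^ (k + 3)" for z
    by (rule power_increasing[OF P(2)]) simp
  from add_mono[OF this[of False] this[of True]]
  have "(2 :: real) ^ one_sided_cost n g P False + 2 ^ one_sided_cost n g P True \<le> 2 ^ (k + 4)"
    by (simp add: power_add)
  then have "protocol_cost n g P \<le> log 2 (2 ^ (k + 4))"
    unfolding protocol_cost_def by (intro log_mono) (simp_all add: add_pos_pos)
  also have "\<dots> = real k + 4" by (simp add: log_nat_power)
  finally show ?thesis using nondet_complexity_attained[of n g] P(1) by (metis order_trans)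
qed

lemma ex_cover_nondet_complexity:
  "\<exists>k. cover n g (2 ^ (k + 1)) \<and> real k \<le> nondet_complexity n g"
proof -
  obtain P where P: "nondet_protocol n g P" "nondet_complexity n g = protocol_cost n g P"
    by (rule nondet_complexity_attained)
  define k where "k = max (one_sided_cost n g P False) (one_sided_cost n g P True)"
  have "one_sided_cost n g P z \<le> k" for z by (cases z) (simp_all add: k_def)
  with P(1) have "cover n g (2 ^ (k + 1))" by (rule protocol_imp_cover)
  moreover have "(2 :: real) ^ k \<le> 2 ^ one_sided_cost n g P False + 2 ^ one_sided_cost n g P True"
    by (simp add: k_def max_def)
  then have "log 2 (2 ^ k) \<le> protocol_cost n g P"
    unfolding protocol_cost_def by (intro log_mono) simp_all
  then have "real k \<le> nondet_complexity n g" by (simp add: P(2) log_nat_power)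
  ultimately show ?thesis by blast
qed

section \<open>From programs to covers, and the comparison\<close>

text \<open>Every string of length at most \<open>k\<close> serves as a row, valid program or not;
  this is harmless because a cover only asks for some consistent row for each \<open>x\<close> and
  \<open>y\<close>.\<close>

lemma ic_imp_cover:
  assumes "\<And>x y. x \<in> strings n \<Longrightarrow> y \<in> strings n \<Longrightarrow> ic f t n y (Y1 f n x) \<le> enat k"
  shows "cover n (f n) (2 ^ (k + 1))"
proof -
  define G where "G p u = (if returns f p u [True] then Some True
    else if returns f p u [False] then Some False else None)" for p u
  show ?thesis
  proof (rule coverI[OF card_short_strings, where G = G])
    fix x y assume xy: "x \<in> strings n" "y \<in> strings n"
    have "ic f t n y (Y1 f n x) < enat (Suc k)"
      using assms[OF xy] by (rule order_le_less_trans) simp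
    then obtain p where p: "ic_program f t n y (Y1 f n x) p" "enat (length p) < enat (Suc k)"
      unfolding ic_def INF_less_iff by blast
    have row: "z = f n x u" if "u \<in> strings n" "G p u = Some z" for u z
      using p(1) that unfolding ic_program_def consistent_def
      by (auto simp: G_def Y1_def split: if_splits)
    from p(1) obtain v where v: "returns f p y v"
      unfolding ic_program_def returns_def by blast
    with p(1) have "v = [True] \<or> v = [False]" unfolding ic_program_def by blast
    with v have "G p y \<noteq> None" by (auto simp: G_def)
    with row[OF xy(2)] have "G p y = Some (f n x y)" by blast
    with row p(2) show "\<exists>i\<in>{u. length u \<le> k}. G i y = Some (f n x y) \<and>
        (\<forall>y'\<in>strings n. \<forall>z. G i y' = Some z \<longrightarrow> z = f n x y')"
      by (intro bexI[of _ p]) auto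
  qed
qed

theorem mainTheorem2:
  fixes f :: "nat \<Rightarrow> bool list \<Rightarrow> bool list \<Rightarrow> bool"
  shows "\<exists>t :: nat \<Rightarrow> nat. computable t \<and>
    (\<exists>c :: real. \<forall>n.
      \<bar>ereal (nondet_complexity n (f n)) -
        ereal_of_enat (MAX (x, y) \<in> strings n \<times> strings n. ic f t n y (Y1 f n x))\<bar> \<le> ereal c)"
proof -
  from ic_le_cover[of f] obtain t c where t: "computable t"
    and ic: "\<And>n l x y. cover n (f n) (2 ^ l) \<Longrightarrow> l \<le> n \<Longrightarrow> x \<in> strings n \<Longrightarrow> y \<in> strings n \<Longrightarrow>
      ic f t n y (Y1 f n x) \<le> enat (l + c)" by blast
  have "\<bar>ereal (nondet_complexity n (f n)) -
      ereal_of_enat (MAX (x, y) \<in> strings n \<times> strings n. ic f t n y (Y1 f n x))\<bar>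
      \<le> ereal (real c + 5)" for n
  proof -
    let ?N = "nondet_complexity n (f n)"
    let ?S = "(\<lambda>(x, y). ic f t n y (Y1 f n x)) ` (strings n \<times> strings n)"
    \<comment> \<open>The logarithm of the least cover by a power of 2, with which both quantities
      are compared.\<close>
    define l where "l = (LEAST l. cover n (f n) (2 ^ l))"
    have l: "cover n (f n) (2 ^ l)"
      unfolding l_def by (rule LeastI[of _ n]) (rule cover_trivial)
    have least: "l \<le> k" if "cover n (f n) (2 ^ k)" for k
      unfolding l_def using that by (rule Least_le)
    have S: "finite ?S" "?S \<noteq> {}"
      using strings_nonempty[of n] by (auto simp: finite_strings)
    have "Max ?S \<le> enat (l + c)"
      using S ic[OF l least[OF cover_trivial]] by (subst Max_le_iff) auto
    then obtain m where m: "Max ?S = enat m" "m \<le> l + c" by (cases "Max ?S") auto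
    have "ic f t n y (Y1 f n x) \<le> enat m" if "x \<in> strings n" "y \<in> strings n" for x y
      unfolding m(1)[symmetric] using S(1) that by (intro Max_ge) auto
    from least[OF ic_imp_cover[OF this]] have "l \<le> m + 1" by simp
    moreover have "?N \<le> real l + 4" using l by (rule nondet_complexity_le)
    moreover obtain k where "cover n (f n) (2 ^ (k + 1))" "real k \<le> ?N"
      using ex_cover_nondet_complexity by blast
    moreover from this(1) have "l \<le> k + 1" by (rule least)
    \<comment> \<open>One direction is \<open>?N \<le> l + 4 \<le> m + 5\<close>, the other
      \<open>m \<le> l + c \<le> k + 1 + c \<le> ?N + 1 + c\<close>.\<close>
    ultimately have "\<bar>?N - real m\<bar> \<le> real c + 5" using m(2) by linarith
    then show ?thesis unfolding m(1) by simp
  qed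
  with t show ?thesis by blast
qed

end
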